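(* Let $S$ be a semitopological semigroup, let $C$ be a bounded convex $L$-embedded subset of a Banach space $X$ and let $(S,(C,\mathrm{weak}))$ be a nonexpansive and continuous dynamical system. If $LUC(S)$ has a left invariant mean and $C$ contains a nonempty bounded subset $A$ such that $s(A)=A$ for all $s\in S$, then there is a fixed point of $S$ in $E_C(A)$.
   Context: A semitopological semigroup is a (nonempty) semigroup $S$ with a Hausdorff topology such that for each $t\in S$ the maps $s\mapsto ts$ and $s\mapsto st$ are continuous. $\ell^\infty(S)$ is the Banach space of bounded complex-valued functions on $S$ with the supremum norm; for $s\in S$, $L_sf(t)=f(st)$. $C(S)$ is the closed subalgebra of bounded continuous functions, and $LUC(S)$ is the space of $f\in C(S)$ for which $s\mapsto L_sf$ is continuous from $S$ to $C(S)$ with the norm topology. A left invariant mean on $LUC(S)$ is $\mu\in LUC(S)^*$ with $\|\mu\|=\mu(1)=1$ and $\mu(L_sf)=\mu(f)$ for all $s\in S$, $f\in LUC(S)$. A dynamical system $(S,C)$ consists of a semitopological semigroup $S$, a topological space $C$ and an action $\pi:S\times C\to C$, $(s,x)\mapsto sx$, with $s_1(s_2x)=(s_1s_2)x$, which is separately continuous. It is called continuous if $\pi$ is jointly continuous. $(S,(C,\mathrm{weak}))$ means that $C$ carries the weak topology of $X$. Nonexpansive means $\|sx-sy\|\le\|x-y\|$ for all $s\in S$, $x,y\in C$. A fixed point is a point $x$ with $sx=x$ for all $s\in S$. $s(A)=\{sx:x\in A\}$. A nonempty subset $C$ of a Banach space $X$ is $L$-embedded if there is a subspace $X_s$ of $X^{**}$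 such that $X\oplus_1X_s\subset X^{**}$ (i.e. the sum $X+X_s$ in $X^{**}$ is direct and $\|x+\xi\|=\|x\|+\|\xi\|$ for $x\in X$, $\xi\in X_s$) and $\overline{C}^{\,\mathrm{weak}^*}\subset C\oplus_1X_s=\{c+\xi:c\in C,\ \xi\in X_s\}$, where $\overline{C}^{\,\mathrm{weak}^*}$ is the closure of $C$ in $X^{**}$ in the weak$^*$ topology of $X^{**}$. The Chebyshev radius of a bounded set $A$ in $C$ is $r_C(A)=\inf_{x\in C}\sup_{y\in A}\|x-y\|$ and the Chebyshev center of $A$ in $C$ is $E_C(A)=\{x\in C:\sup_{y\in A}\|x-y\|=r_C(A)\}$. *)

theory Defs
  imports "HOL-Analysis.Analysis"
begin

class semitopological_semigroup = semigroup_mult + t2_space +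
  assumes open_vimage_mult_left: "open U \<Longrightarrow> open ((\<lambda>s. t * s) -` U)"
    and open_vimage_mult_right: "open U \<Longrightarrow> open ((\<lambda>s. s * t) -` U)"

lemma continuous_mult_left: "continuous_on UNIV (\<lambda>s::'s::semitopological_semigroup. t * s)"
  by (simp add: continuous_on_open_vimage open_vimage_mult_left)

lemma continuous_mult_right: "continuous_on UNIV (\<lambda>s::'s::semitopological_semigroup. s * t)"
  by (simp add: continuous_on_open_vimage open_vimage_mult_right)

definition left_translate ::
    "'s::semitopological_semigroup \<Rightarrow> ('s \<Rightarrow>\<^sub>C complex) \<Rightarrow> ('s \<Rightarrow>\<^sub>C complex)" where
  "left_translate s f = Bcontfun (\<lambda>t. f (s * t))"

lemma apply_left_translate [simp]: "left_translate s f t = f (s * t)"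
proof -
  have "continuous_on UNIV (\<lambda>t. f (s * t))"
    by (rule continuous_on_compose2[OF continuous_on_apply_bcontfun[of UNIV] continuous_mult_left]) simp
  moreover have "bounded (range (\<lambda>t. f (s * t)))"
    by (rule bounded_subset[OF bounded_apply_bcontfun[of f]]) auto
  ultimately have "(\<lambda>t. f (s * t)) \<in> bcontfun"
    by (simp add: bcontfun_def)
  then show ?thesis
    by (simp add: left_translate_def Bcontfun_inverse)
qed

(* The library makes the type of bounded continuous functions a real vector space only. *)
definition cscale :: "complex \<Rightarrow> ('s::topological_space \<Rightarrow>\<^sub>C complex) \<Rightarrow> ('s \<Rightarrow>\<^sub>C complex)" where
  "cscale c f = Bcontfun (\<lambda>t. c * f t)"

lemma apply_cscale [simp]: "cscale c f t = c * f t"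
proof -
  have "bounded ((\<lambda>z. c * z) ` range f)"
    by (intro bounded_linear_image bounded_linear_mult_right) simp
  then have "(\<lambda>t. c * f t) \<in> bcontfun"
    by (auto simp: bcontfun_def image_image intro!: continuous_intros)
  then show ?thesis
    by (simp add: cscale_def Bcontfun_inverse)
qed

definition LUC :: "('s::semitopological_semigroup \<Rightarrow>\<^sub>C complex) set" where
  "LUC = {f. continuous_on UNIV (\<lambda>s. left_translate s f)}"

(* Members of the complex dual of LUC are represented by functions on the whole type of which only
   the values on LUC matter; luc_norm is the dual norm provided the functional is bounded. *)
definition luc_functional :: "(('s::semitopological_semigroup \<Rightarrow>\<^sub>C complex) \<Rightarrow> complex) \<Rightarrow> bool" where
  "luc_functional \<mu> \<longleftrightarrow>
     (\<forall>f\<in>LUC. \<forall>g\<in>LUC. \<mu> (f + g) = \<mu> f + \<mu> g) \<and>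
     (\<forall>c. \<forall>f\<in>LUC. \<mu> (cscale c f) = c * \<mu> f) \<and>
     (\<exists>K. \<forall>f\<in>LUC. cmod (\<mu> f) \<le> K * norm f)"

definition luc_norm :: "(('s::semitopological_semigroup \<Rightarrow>\<^sub>C complex) \<Rightarrow> complex) \<Rightarrow> real" where
  "luc_norm \<mu> = (SUP f\<in>{f\<in>LUC. norm f \<le> 1}. cmod (\<mu> f))"

definition left_invariant_mean :: "(('s::semitopological_semigroup \<Rightarrow>\<^sub>C complex) \<Rightarrow> complex) \<Rightarrow> bool" where
  "left_invariant_mean \<mu> \<longleftrightarrow>
     luc_functional \<mu> \<and> luc_norm \<mu> = 1 \<and> \<mu> (const_bcontfun 1) = 1 \<and>
     (\<forall>s. \<forall>f\<in>LUC. \<mu> (left_translate s f) = \<mu> f)"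

(* The phase space is the topological space T with underlying set topspace T; only the values of
   act on that set matter. *)
definition dynamical_system ::
    "('s::semitopological_semigroup \<Rightarrow> 'x \<Rightarrow> 'x) \<Rightarrow> 'x topology \<Rightarrow> bool" where
  "dynamical_system act T \<longleftrightarrow>
     (\<forall>s. \<forall>x\<in>topspace T. act s x \<in> topspace T) \<and>
     (\<forall>s t. \<forall>x\<in>topspace T. act s (act t x) = act (s * t) x) \<and>
     (\<forall>s. continuous_map T T (act s)) \<and>
     (\<forall>x\<in>topspace T. continuous_map euclidean T (\<lambda>s. act s x))"

definition continuous_dynamical_system ::
    "('s::semitopological_semigroup \<Rightarrow> 'x \<Rightarrow> 'x) \<Rightarrow> 'x topology \<Rightarrow> bool" where
  "continuous_dynamical_system act T \<longleftrightarrow>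
     dynamical_system act T \<and>
     continuous_map (prod_topology euclidean T) T (\<lambda>(s, x). act s x)"

definition nonexpansive_on ::
    "'a::real_normed_vector set \<Rightarrow> ('s \<Rightarrow> 'a \<Rightarrow> 'a) \<Rightarrow> bool" where
  "nonexpansive_on C act \<longleftrightarrow> (\<forall>s. \<forall>x\<in>C. \<forall>y\<in>C. norm (act s x - act s y) \<le> norm (x - y))"

(* The euclidean topology on a function space is the product topology, i.e. that of pointwise
   convergence; so the strong operator topology on a dual space is its weak-star topology. *)
definition weak_topology :: "'a::real_normed_vector topology" where
  "weak_topology = pullback_topology UNIV (\<lambda>x (f :: 'a \<Rightarrow>\<^sub>L real). blinfun_apply f x) euclidean"

abbreviation weak_star_topology :: "('a::real_normed_vector \<Rightarrow>\<^sub>L real) topology" where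
  "weak_star_topology \<equiv> strong_operator_topology"

definition bidual_embed :: "'a::real_normed_vector \<Rightarrow> (('a \<Rightarrow>\<^sub>L real) \<Rightarrow>\<^sub>L real)" where
  "bidual_embed x = Blinfun (\<lambda>f. blinfun_apply f x)"

lemma bidual_embed_apply [simp]: "blinfun_apply (bidual_embed x) f = blinfun_apply f x"
  by (simp add: bidual_embed_def bounded_linear_Blinfun_apply blinfun.bounded_linear_left)

(* Duals are real. This covers complex scalars: taking real parts identifies the complex (bi)dual of a
   complex Banach space, isometrically and weak-star homeomorphically, with that of the underlying
   real space, and complex subspaces are real subspaces. *)
definition L_embedded :: "'a::banach set \<Rightarrow> bool" where
  "L_embedded C \<longleftrightarrow> C \<noteq> {} \<and>
     (\<exists>Xs :: (('a \<Rightarrow>\<^sub>L real) \<Rightarrow>\<^sub>L real) set.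
        subspace Xs \<and>
        range bidual_embed \<inter> Xs = {0} \<and>
        (\<forall>x. \<forall>\<xi>\<in>Xs. norm (bidual_embed x + \<xi>) = norm x + norm \<xi>) \<and>
        weak_star_topology closure_of (bidual_embed ` C) \<subseteq> {bidual_embed c + \<xi> |c \<xi>. c \<in> C \<and> \<xi> \<in> Xs})"

definition chebyshev_radius :: "'a::real_normed_vector set \<Rightarrow> 'a set \<Rightarrow> real" where
  "chebyshev_radius C A = (INF x\<in>C. SUP y\<in>A. norm (x - y))"

definition chebyshev_center :: "'a::real_normed_vector set \<Rightarrow> 'a set \<Rightarrow> 'a set" where
  "chebyshev_center C A = {x \<in> C. (SUP y\<in>A. norm (x - y)) = chebyshev_radius C A}"

end

theory Submission
  imports Defs
begin

text \<open>
  The Chebyshev center \<open>E\<close> of \<open>A\<close> in \<open>C\<close> is convex, invariant (because \<open>s(A) = A\<close>), and, by Banach-Alaoglu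
  and the \<open>\<ell>\<^sup>1\<close>-splitting of weak* limit points of \<open>C\<close>, nonempty and weakly compact. Let \<open>K\<close> be a minimal
  weakly compact convex invariant subset of \<open>E\<close>, and \<open>F\<close> a minimal weakly compact invariant subset of \<open>K\<close>.
  Evaluating the mean along an orbit gives an invariant positive functional \<open>m\<close> on the weakly continuous
  functions on \<open>F\<close>; minimality makes its support all of \<open>F\<close>, whence \<open>s(F) = F\<close>. By fragmentability some
  small norm ball has positive mass, and by minimality all balls of that radius have mass bounded
  below. So \<open>F\<close> has a finite net \<open>N\<close> finer than its diameter \<open>d\<close>. The mean of \<open>N\<close> lies at distance at most
  some \<open>\<rho> < d\<close> from every point of \<open>F\<close>. The points of \<open>K\<close> with this property form a convex invariant
  set, which must be \<open>K\<close>; but it cannot contain \<open>F\<close> unless \<open>F\<close> is a single point, fixed by \<open>S\<close>.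
\<close>

section \<open>The Hahn-Banach theorem\<close>

text \<open>Homogeneity is asked for only as an inequality at positive factors, which passes easily
  to infima; \<open>sublinear_scale\<close> recovers equality by using the factor
  \<open>1 / c\<close> as well.\<close>

definition sublinear :: "('a::real_vector \<Rightarrow> real) \<Rightarrow> bool" where
  "sublinear p \<longleftrightarrow> (\<forall>x y. p (x + y) \<le> p x + p y) \<and> (\<forall>c>0. \<forall>x. p (c *\<^sub>R x) \<le> c * p x)"

lemma sublinear_add: "sublinear p \<Longrightarrow> p (x + y) \<le> p x + p y"
  and sublinear_scale_le: "sublinear p \<Longrightarrow> c > 0 \<Longrightarrow> p (c *\<^sub>R x) \<le> c * p x"
  by (auto simp: sublinear_def)

lemma sublinear_zero: "sublinear p \<Longrightarrow> p 0 = 0"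
  \<comment> \<open>The factors 2 and 1/2 bound \<open>p 0\<close> by 0 from below and from
    above.\<close>
  using sublinear_scale_le[of p 2 0] sublinear_scale_le[of p "1/2" 0] by simp

lemma sublinear_scale:
  assumes "sublinear p" "c \<ge> 0"
  shows "p (c *\<^sub>R x) = c * p x"
proof (cases "c = 0")
  case False
  then have c: "c > 0"
    using assms by simp
  have "p ((1 / c) *\<^sub>R (c *\<^sub>R x)) \<le> (1 / c) * p (c *\<^sub>R x)"
    using assms c by (intro sublinear_scale_le) auto
  then have "c * p x \<le> p (c *\<^sub>R x)"
    using c by (simp add: field_simps)
  then show ?thesis
    using sublinear_scale_le[OF assms(1) c, of x] by simp
qed (simp add: sublinear_zero assms)

lemma sublinear_minus: "sublinear p \<Longrightarrow> - p (- x) \<le> p x"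
  using sublinear_add[of p x "-x"] by (simp add: sublinear_zero)

text \<open>The step behind linearity: the infimum of \<open>q (x + t *\<^sub>R y) - t * q y\<close>
  over \<open>t \<ge> 0\<close> is again sublinear, \<open>t = 0\<close> puts it below
  \<open>q\<close>, and \<open>t = 1\<close> gives the bound at \<open>- y\<close>. A minimal
  sublinear functional cannot drop in this way and is therefore odd.\<close>

lemma sublinear_reduce:
  assumes q: "sublinear q"
  obtains q' where "sublinear q'" "\<And>x. q' x \<le> q x" "q' (- y) \<le> - q y"
proof -
  define r where "r x t = q (x + t *\<^sub>R y) - t * q y" for x t
  define q' where "q' x = (INF t\<in>{0..}. r x t)" for x
  \<comment> \<open>Writing \<open>t *\<^sub>R y\<close> as the sum of
    \<open>x + t *\<^sub>R y\<close> and \<open>- x\<close> gives a lower bound free of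
    \<open>t\<close>, so the infimum is a genuine one.\<close>
  have low: "- q (- x) \<le> r x t" if "t \<ge> 0" for x t
    using sublinear_add[OF q, of "x + t *\<^sub>R y" "-x"] sublinear_scale[OF q that, of y]
    by (simp add: r_def)
  then have bdd: "bdd_below (r x ` {0..})" for x
    by (intro bdd_belowI2[of _ "- q (- x)"]) auto
  have le: "q' x \<le> r x t" if "t \<ge> 0" for x t
    unfolding q'_def using that by (intro cINF_lower bdd) auto
  have ge: "m \<le> q' x" if "\<And>t. t \<ge> 0 \<Longrightarrow> m \<le> r x t" for x m
    unfolding q'_def using that by (intro cINF_greatest) auto
  have "q' (x1 + x2) \<le> q' x1 + q' x2" for x1 x2
  proof -
    have "q' (x1 + x2) - r x1 t1 \<le> r x2 t2" if "t1 \<ge> 0" "t2 \<ge> 0" for t1 t2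
    proof -
      have "q' (x1 + x2) \<le> r (x1 + x2) (t1 + t2)"
        using that by (intro le) auto
      also have "\<dots> \<le> r x1 t1 + r x2 t2"
        using sublinear_add[OF q, of "x1 + t1 *\<^sub>R y" "x2 + t2 *\<^sub>R y"]
        by (simp add: r_def algebra_simps)
      finally show ?thesis by simp
    qed
    then have "q' (x1 + x2) - q' x2 \<le> r x1 t1" if "t1 \<ge> 0" for t1
      using ge[of "q' (x1 + x2) - r x1 t1" x2] that by force
    from ge[OF this] show ?thesis by simp
  qed
  moreover have "q' (c *\<^sub>R x) \<le> c * q' x" if c: "c > 0" for c x
  proof -
    have "q' (c *\<^sub>R x) / c \<le> r x t" if "t \<ge> 0" for t
    proof -
      have "q' (c *\<^sub>R x) \<le> r (c *\<^sub>R x) (c * t)"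
        using that c by (intro le) auto
      also have "\<dots> = c * r x t"
        using sublinear_scale[OF q, of c "x + t *\<^sub>R y"] c by (simp add: r_def algebra_simps)
      finally show ?thesis using c by (simp add: field_simps)
    qed
    from ge[OF this] show ?thesis using c by (simp add: field_simps)
  qed
  ultimately have "sublinear q'"
    by (simp add: sublinear_def)
  moreover have "q' x \<le> q x" for x
    using le[of 0 x] by (simp add: r_def)
  moreover have "q' (- y) \<le> - q y"
    using le[of 1 "-y"] by (simp add: r_def sublinear_zero[OF q])
  ultimately show thesis by (rule that)
qed

text \<open>A pointwise minimal sublinear functional is linear; no partial functionals are extended.\<close>

theorem Hahn_Banach_sublinear:
  assumes p: "sublinear p"
  obtains g where "linear g" "\<And>x. g x \<le> p x" "g z = p z"
proof -
  \<comment> \<open>Reducing at \<open>z\<close> before minimizing secures the value there: every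
    odd minorant \<open>m\<close> of \<open>p'\<close> satisfies
    \<open>- m z \<le> - p z\<close>.\<close>
  obtain p' where p': "sublinear p'" "\<And>x. p' x \<le> p x" "p' (- z) \<le> - p z"
    using sublinear_reduce[OF p, of z] by metis
  define \<A> where "\<A> = {q. sublinear q \<and> q \<le> p'}"
  have "\<exists>m\<in>\<A>. \<forall>q\<in>\<A>. m \<ge> q \<longrightarrow> q = m"
  proof (rule predicate_Zorn)
    show "partial_order_on \<A> (relation_of (\<ge>) \<A>)"
      by (auto simp: partial_order_on_def preorder_on_def refl_on_def relation_of_def
          intro!: transI antisymI)
  next
    fix \<C> assume "\<C> \<in> Chains (relation_of (\<ge>) \<A>)"
    then have sub: "\<C> \<subseteq> \<A>" and lin: "\<And>q r. q \<in> \<C> \<Longrightarrow> r \<in> \<C> \<Longrightarrow> q \<le> r \<or> r \<le> q"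
      by (auto simp: Chains_def relation_of_def)
    show "\<exists>u\<in>\<A>. \<forall>q\<in>\<C>. q \<ge> u"
    proof (cases "\<C> = {}")
      case True
      then show ?thesis using p' by (auto simp: \<A>_def)
    next
      case False
      define u where "u x = (INF q\<in>\<C>. q x)" for x
      have "- p' (- x) \<le> q x" if "q \<in> \<C>" for q x
      proof -
        have "sublinear q" "q (- x) \<le> p' (- x)"
          using that sub by (auto simp: \<A>_def le_fun_def)
        then show ?thesis
          using sublinear_minus[of q x] by linarith
      qed
      then have bdd: "bdd_below ((\<lambda>q. q x) ` \<C>)" for x
        by (intro bdd_belowI2[of _ "- p' (- x)"]) auto
      have le: "u x \<le> q x" if "q \<in> \<C>" for q x
        unfolding u_def using that by (intro cINF_lower bdd)
      have ge: "m \<le> u x" if "\<And>q. q \<in> \<C> \<Longrightarrow> m \<le> q x" for m x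
        unfolding u_def using that False by (intro cINF_greatest) auto
      have "u (x + y) \<le> u x + u y" for x y
      proof -
        have "u (x + y) - q x \<le> r y" if qr: "q \<in> \<C>" "r \<in> \<C>" for q r
        proof -
          \<comment> \<open>Comparability in the chain supplies one member below both
            \<open>q\<close> and \<open>r\<close>, whose subadditivity passes to the
            infimum.\<close>
          obtain s where s: "s \<in> \<C>" "s \<le> q" "s \<le> r"
            using lin[OF qr] qr by auto
          have "u (x + y) \<le> s x + s y"
            using le[OF s(1), of "x + y"] sublinear_add[of s x y] s(1) sub by (force simp: \<A>_def)
          also have "\<dots> \<le> q x + r y"
            using s by (intro add_mono) (auto simp: le_fun_def)
          finally show ?thesis by simp
        qed
        then have *: "u (x + y) - u y \<le> q x" if "q \<in> \<C>" for q
          using ge[of "u (x + y) - q x" y] that by force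
        have "u (x + y) - u y \<le> u x"
          by (rule ge) (rule *)
        then show ?thesis by simp
      qed
      moreover have "u (c *\<^sub>R x) \<le> c * u x" if c: "c > 0" for c x
      proof -
        have *: "u (c *\<^sub>R x) / c \<le> q x" if "q \<in> \<C>" for q
          using le[OF that, of "c *\<^sub>R x"] sublinear_scale_le[of q c x] c that sub
          by (force simp: \<A>_def field_simps)
        have "u (c *\<^sub>R x) / c \<le> u x"
          by (rule ge) (rule *)
        then show ?thesis using c by (simp add: field_simps)
      qed
      moreover have "u \<le> p'"
      proof -
        obtain q where q: "q \<in> \<C>" using False by auto
        then have "u \<le> q" "q \<le> p'"
          using le sub by (auto simp: \<A>_def le_fun_def)
        then show ?thesis by (rule order_trans)
      qed
      ultimately have "u \<in> \<A>"
        by (simp add: \<A>_def sublinear_def)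
      then show ?thesis using le by (auto simp: le_fun_def)
    qed
  qed
  then obtain m where m: "sublinear m" "m \<le> p'" and min: "\<And>q. q \<in> \<A> \<Longrightarrow> q \<le> m \<Longrightarrow> q = m"
    by (auto simp: \<A>_def)
  \<comment> \<open>Minimality identifies the reduction of \<open>m\<close> at \<open>x\<close> with
    \<open>m\<close> itself; its bound at \<open>- x\<close> then meets the reverse inequality of
    \<open>sublinear_minus\<close>.\<close>
  have odd: "m (- x) = - m x" for x
  proof -
    obtain q where q: "sublinear q" "\<And>x. q x \<le> m x" "q (- x) \<le> - m x"
      using sublinear_reduce[OF m(1), of x] by metis
    then have "q \<in> \<A>" "q \<le> m"
      using m(2) by (auto simp: \<A>_def le_fun_def intro: order_trans)
    then have "q = m"
      by (rule min)
    then show ?thesis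
      using q(3) sublinear_minus[OF m(1), of x] by simp
  qed
  have "linear m"
  proof (rule linearI)
    show "m (x + y) = m x + m y" for x y
      using sublinear_add[OF m(1), of x y] sublinear_add[OF m(1), of "-x" "-y"] odd[of "x + y"]
      by (simp add: odd)
    show "m (c *\<^sub>R x) = c *\<^sub>R m x" for c x
      using sublinear_scale[OF m(1), of c x] sublinear_scale[OF m(1), of "-c" x] odd[of "c *\<^sub>R x"]
      by (cases "c \<ge> 0") auto
  qed
  moreover have m_le: "m x \<le> p x" for x
    using m(2) p'(2) by (auto simp: le_fun_def intro: order_trans)
  moreover have "m z = p z"
  proof -
    have "m (- z) \<le> p' (- z)"
      using m(2) by (simp add: le_fun_def)
    then show ?thesis
      using p'(3) odd[of z] m_le[of z] by linarith
  qed
  ultimately show thesis by (rule that)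
qed

lemma Hahn_Banach_seminorm:
  fixes p :: "'a::real_normed_vector \<Rightarrow> real"
  assumes p: "sublinear p" and le: "\<And>x. p x \<le> norm x"
  obtains g :: "'a \<Rightarrow>\<^sub>L real" where "\<And>x. g x \<le> p x" "g z = p z" "\<And>x. \<bar>g x\<bar> \<le> norm x"
proof -
  obtain g where g: "linear g" "\<And>x. g x \<le> p x" "g z = p z"
    using Hahn_Banach_sublinear[OF p, of z] by metis
  have abs: "\<bar>g x\<bar> \<le> norm x" for x
    using g(2)[of x] g(2)[of "-x"] le[of x] le[of "-x"] linear_neg[OF g(1), of x]
    by simp
  have "bounded_linear g"
    using g(1) abs by (intro bounded_linear_intro[where K=1])
       (auto simp: linear_add linear_scale)
  then show thesis
    using g abs by (intro that[of "Blinfun g"]) (auto simp: bounded_linear_Blinfun_apply)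
qed

lemma norming_functional:
  fixes z :: "'a::real_normed_vector"
  obtains g :: "'a \<Rightarrow>\<^sub>L real" where "g z = norm z" "\<And>x. \<bar>g x\<bar> \<le> norm x"
  by (rule Hahn_Banach_seminorm[of norm z])
     (auto simp: sublinear_def norm_triangle_ineq)

text \<open>Hahn-Banach is applied to the distance from \<open>Y\<close>, a sublinear functional
  below the norm that vanishes on \<open>Y\<close> and is positive at \<open>z\<close>.\<close>

lemma functional_vanishing_on_subspace:
  fixes Y :: "'a::real_normed_vector set"
  assumes Y: "subspace Y" and z: "z \<notin> closure Y"
  obtains g :: "'a \<Rightarrow>\<^sub>L real" where "g z > 0" "\<And>y. y \<in> Y \<Longrightarrow> g y = 0"
proof -
  have ne: "Y \<noteq> {}"
    using subspace_0[OF Y] by auto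
  define p where "p x = infdist x Y" for x
  have lt: "\<exists>a\<in>Y. dist x a < e" if "infdist x Y < e" for x e
    using that ne by (simp add: infdist_notempty cINF_less_iff)
  have "p (x + y) \<le> p x + p y" for x y
  proof (rule field_le_epsilon)
    fix e :: real assume e: "e > 0"
    obtain a b where ab: "a \<in> Y" "dist x a < p x + e/2" "b \<in> Y" "dist y b < p y + e/2"
      using lt[of x "p x + e/2"] lt[of y "p y + e/2"] e by (auto simp: p_def)
    have "p (x + y) \<le> dist (x + y) (a + b)"
      using ab subspace_add[OF Y] by (auto simp: p_def intro: infdist_le)
    also have "\<dots> \<le> dist x a + dist y b"
      by (rule dist_triangle_add)
    finally show "p (x + y) \<le> p x + p y + e"
      using ab by simp
  qed
  moreover have "p (c *\<^sub>R x) \<le> c * p x" if c: "c > 0" for c x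
  proof (rule field_le_epsilon)
    fix e :: real assume e: "e > 0"
    obtain a where a: "a \<in> Y" "dist x a < p x + e/c"
      using lt[of x "p x + e/c"] e c by (auto simp: p_def)
    have "p (c *\<^sub>R x) \<le> dist (c *\<^sub>R x) (c *\<^sub>R a)"
      using a subspace_scale[OF Y] by (auto simp: p_def intro: infdist_le)
    also have "\<dots> = c * dist x a"
      using c by (simp add: dist_norm flip: scaleR_diff_right)
    also have "\<dots> \<le> c * (p x + e/c)"
      using a c by (intro mult_left_mono) auto
    finally show "p (c *\<^sub>R x) \<le> c * p x + e"
      using c by (simp add: algebra_simps)
  qed
  ultimately have "sublinear p"
    by (simp add: sublinear_def)
  moreover have "p x \<le> norm x" for x
    using infdist_le[OF subspace_0[OF Y], of x] by (simp add: p_def)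
  ultimately obtain g :: "'a \<Rightarrow>\<^sub>L real"
    where g: "\<And>x. g x \<le> p x" "g z = p z"
    using Hahn_Banach_seminorm[of p z] by metis
  have "g z > 0"
    using z ne infdist_nonneg[of z Y] in_closure_iff_infdist_zero[OF ne, of z]
    unfolding g(2) p_def by linarith
  moreover have "g y = 0" if "y \<in> Y" for y
    using g(1)[of y] g(1)[of "-y"] that subspace_neg[OF Y that]
    by (simp add: p_def blinfun.minus_right)
  ultimately show thesis by (rule that)
qed

section \<open>The weak topology\<close>

lemma topspace_weak_topology [simp]: "topspace weak_topology = UNIV"
  by (simp add: weak_topology_def topspace_pullback_topology)

lemma continuous_map_weak_topology [continuous_intros]:
  "continuous_map weak_topology euclideanreal (\<lambda>x. blinfun_apply g x)"
proof -
  have "continuous_map euclidean euclideanreal (\<lambda>h::_ \<Rightarrow>\<^sub>L real \<Rightarrow> real. h g)"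
    by (simp add: continuous_on_product_coordinates)
  from continuous_map_pullback[OF this, of UNIV "\<lambda>x f. blinfun_apply f x"]
  show ?thesis
    by (simp add: weak_topology_def o_def)
qed

lemma Hausdorff_weak_topology: "Hausdorff_space (weak_topology :: 'a::real_normed_vector topology)"
  unfolding Hausdorff_space_def
proof (intro allI impI, elim conjE)
  fix x y :: 'a assume "x \<noteq> y"
  obtain g :: "'a \<Rightarrow>\<^sub>L real" where "g (x - y) = norm (x - y)"
    using norming_functional[of "x - y"] by metis
  then have "g x \<noteq> g y"
    using \<open>x \<noteq> y\<close> by (auto simp: blinfun.diff_right)
  then obtain U V where UV: "open U" "open V" "g x \<in> U" "g y \<in> V" "U \<inter> V = {}"
    by (metis hausdorff)
  have "openin weak_topology {x \<in> topspace weak_topology. g x \<in> W}" if "open W" for W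
    using that by (intro openin_continuous_map_preimage[OF continuous_map_weak_topology]) auto
  then have "openin weak_topology {x. g x \<in> W}" if "open W" for W
    using that by simp
  then show "\<exists>U V. openin weak_topology U \<and> openin weak_topology V \<and> x \<in> U \<and> y \<in> V \<and> disjnt U V"
    using UV by (intro exI[of _ "{x. g x \<in> U}"] exI[of _ "{x. g x \<in> V}"]) (auto simp: disjnt_def)
qed

lemma norm_gt_iff_functional:
  fixes x :: "'a::real_normed_vector"
  shows "r < norm x \<longleftrightarrow> (\<exists>g :: 'a \<Rightarrow>\<^sub>L real. (\<forall>y. \<bar>g y\<bar> \<le> norm y) \<and> r < g x)"
  by (metis norming_functional abs_ge_self order.strict_trans2)

text \<open>Weak lower semicontinuity of the norm: the set is a union of weakly open ones, over the
  functionals of norm at most 1. The joint form in two points serves the tube argument for ball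
  masses.\<close>

lemma openin_weak_norm_gt:
  "openin (prod_topology weak_topology weak_topology)
     {(x, y). r < norm (x - y :: 'a::real_normed_vector)}"
proof -
  let ?P = "prod_topology weak_topology weak_topology :: ('a \<times> 'a) topology"
  define G where "G = {g :: 'a \<Rightarrow>\<^sub>L real. \<forall>y. \<bar>g y\<bar> \<le> norm y}"
  have "continuous_map ?P euclideanreal (\<lambda>z. g (fst z) - g (snd z))" for g :: "'a \<Rightarrow>\<^sub>L real"
    by (intro continuous_map_diff continuous_map_compose[OF continuous_map_fst, unfolded o_def]
        continuous_map_compose[OF continuous_map_snd, unfolded o_def] continuous_map_weak_topology)
  then have "openin ?P {z \<in> topspace ?P. g (fst z) - g (snd z) \<in> {r<..}}" for g :: "'a \<Rightarrow>\<^sub>L real"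
    by (rule openin_continuous_map_preimage) auto
  then have "openin ?P (\<Union>g\<in>G. {z \<in> topspace ?P. blinfun_apply g (fst z) - g (snd z) \<in> {r<..}})"
    by auto
  also have "(\<Union>g\<in>G. {z \<in> topspace ?P. blinfun_apply g (fst z) - g (snd z) \<in> {r<..}})
      = {(x, y). r < norm (x - y)}"
    by (auto simp: G_def norm_gt_iff_functional[of r] blinfun.diff_right)
  finally show ?thesis .
qed

lemma closedin_weak_cball: "closedin weak_topology (cball (x :: 'a::real_normed_vector) r)"
proof -
  have "continuous_map weak_topology (prod_topology weak_topology weak_topology) (\<lambda>y. (x, y))"
    by (simp add: continuous_map_paired)
  from openin_continuous_map_preimage[OF this openin_weak_norm_gt, of r]
  show ?thesis
    by (simp add: closedin_def dist_norm Compl_eq_Diff_UNIV[symmetric] not_le Collect_neg_eq[symmetric] cball_def)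
qed

text \<open>A linear form of Mazur's theorem: a point off the closed span is separated by a
  functional vanishing on the span, and positivity of that functional is a weakly open
  condition.\<close>

lemma weak_closure_subset_closure_span:
  fixes B :: "'a::real_normed_vector set"
  shows "weak_topology closure_of B \<subseteq> closure (span B)"
proof
  fix z assume z: "z \<in> weak_topology closure_of B"
  show "z \<in> closure (span B)"
  proof (rule ccontr)
    assume "z \<notin> closure (span B)"
    then obtain g :: "'a \<Rightarrow>\<^sub>L real" where g: "g z > 0" "\<And>y. y \<in> span B \<Longrightarrow> g y = 0"
      using functional_vanishing_on_subspace[OF subspace_span] by metis
    have "openin weak_topology {x \<in> topspace weak_topology. g x \<in> {0<..}}"
      by (rule openin_continuous_map_preimage[OF continuous_map_weak_topology]) auto
    with z g(1) obtain y where "y \<in> B" "g y > 0"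
      unfolding in_closure_of by force
    then show False
      using g(2)[OF span_base] by force
  qed
qed

section \<open>Chebyshev centers of L-embedded sets\<close>

lemma topspace_weak_star_topology [simp]: "topspace weak_star_topology = UNIV"
  by (rule strong_operator_topology_topspace)

text \<open>The ball is an intersection of closed conditions on the values at single vectors, and
  evaluations are weak-star continuous.\<close>

lemma closedin_weak_star_cball:
  "closedin weak_star_topology (cball (\<phi> :: 'a::real_normed_vector \<Rightarrow>\<^sub>L real) r)"
proof (cases "r \<ge> 0")
  case True
  have "cball \<phi> r = (\<Inter>x. {\<psi> \<in> topspace weak_star_topology. blinfun_apply \<psi> x \<in> cball (blinfun_apply \<phi> x) (r * norm x)})"
  proof (intro set_eqI iffI)
    fix \<psi> assume "\<psi> \<in> cball \<phi> r"
    then have "norm (\<phi> - \<psi>) \<le> r"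
      by (simp add: dist_norm)
    then have "norm ((\<phi> - \<psi>) x) \<le> r * norm x" for x
      by (meson norm_blinfun order_trans mult_right_mono norm_ge_zero)
    then show "\<psi> \<in> (\<Inter>x. {\<psi> \<in> topspace weak_star_topology. blinfun_apply \<psi> x \<in> cball (blinfun_apply \<phi> x) (r * norm x)})"
      by (auto simp: dist_norm blinfun.diff_left)
  next
    fix \<psi> assume "\<psi> \<in> (\<Inter>x. {\<psi> \<in> topspace weak_star_topology. blinfun_apply \<psi> x \<in> cball (blinfun_apply \<phi> x) (r * norm x)})"
    then have "norm (\<phi> - \<psi>) \<le> r"
      by (intro norm_blinfun_bound True) (auto simp: dist_norm blinfun.diff_left)
    then show "\<psi> \<in> cball \<phi> r"
      by (simp add: dist_norm)
  qed
  also have "closedin weak_star_topology \<dots>"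
    by (intro closedin_INT closedin_continuous_map_preimage[OF strong_operator_topology_continuous_evaluation]) auto
  finally show ?thesis .
qed (simp add: cball_empty)

text \<open>Tychonoff: in a compact product of intervals the linear functions form a closed set
  \<open>L\<close>, which \<open>Blinfun\<close> maps continuously onto the ball.\<close>

theorem Banach_Alaoglu:
  "compactin weak_star_topology (cball (0 :: 'a::real_normed_vector \<Rightarrow>\<^sub>L real) M)"
proof (cases "M \<ge> 0")
  case M: True
  define P where "P = (\<Pi>\<^sub>E x\<in>(UNIV::'a set). {- (M * norm x)..M * norm x})"
  define L where "L = P \<inter> {h. \<forall>x y. h (x + y) = h x + h y} \<inter> {h. \<forall>c x. h (c *\<^sub>R x) = c * h x}"
  have bl: "bounded_linear h" if "h \<in> L" for h
    using that by (intro bounded_linear_intro[where K=M]) (auto simp: L_def P_def PiE_def Pi_def abs_le_iff minus_le_iff mult.commute)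
  have img: "Blinfun ` L = cball 0 M"
  proof (intro equalityI subsetI)
    fix \<phi> assume "\<phi> \<in> Blinfun ` L"
    then obtain h where h: "h \<in> L" "\<phi> = Blinfun h" by auto
    have "norm \<phi> \<le> M"
      using h M bl[OF h(1)]
      by (intro norm_blinfun_bound) (auto simp: bounded_linear_Blinfun_apply L_def P_def PiE_def Pi_def abs_le_iff minus_le_iff)
    then show "\<phi> \<in> cball 0 M" by simp
  next
    fix \<phi> :: "'a \<Rightarrow>\<^sub>L real" assume "\<phi> \<in> cball 0 M"
    then have "\<bar>\<phi> x\<bar> \<le> M * norm x" for x
      using norm_blinfun[of \<phi> x] mult_right_mono[of "norm \<phi>" M "norm x"] by simp
    then have "blinfun_apply \<phi> \<in> L"
      by (auto simp: L_def P_def abs_le_iff minus_le_iff blinfun.add_right blinfun.scaleR_right)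
    then show "\<phi> \<in> Blinfun ` L"
      by (metis blinfun_apply_inverse image_eqI)
  qed
  have "compactin (product_topology (\<lambda>_::'a. euclideanreal) UNIV) P"
    unfolding P_def compactin_PiE by auto
  then have "compact P"
    by (simp add: euclidean_product_topology)
  moreover have "closed {h::'a \<Rightarrow> real. \<forall>x y. h (x + y) = h x + h y}"
    by (intro closed_Collect_all closed_Collect_eq continuous_intros continuous_on_product_coordinates)
  moreover have "closed {h::'a \<Rightarrow> real. \<forall>c x. h (c *\<^sub>R x) = c * h x}"
    by (intro closed_Collect_all closed_Collect_eq continuous_intros continuous_on_product_coordinates)
  ultimately have "compact L"
    by (simp add: L_def compact_Int_closed)
  moreover have "continuous_map (top_of_set L) weak_star_topology Blinfun"
    unfolding strong_operator_topology_def
  proof (rule continuous_map_pullback')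
    show "continuous_map (top_of_set L) euclidean (blinfun_apply \<circ> Blinfun)"
      by (rule continuous_map_eq[of _ _ id]) (auto simp: bounded_linear_Blinfun_apply bl)
  qed auto
  ultimately have "compactin weak_star_topology (Blinfun ` L)"
    by (intro image_compactin[of "top_of_set L"]) (auto simp: compactin_subtopology)
  then show ?thesis
    by (simp add: img)
qed (simp add: cball_empty)

section \<open>The canonical embedding into the bidual\<close>

lemma inj_bidual_embed: "inj (bidual_embed :: 'a::real_normed_vector \<Rightarrow> _)"
proof (rule injI)
  fix x y :: 'a assume *: "bidual_embed x = bidual_embed y"
  obtain g :: "'a \<Rightarrow>\<^sub>L real" where "g (x - y) = norm (x - y)"
    using norming_functional[of "x - y"] by metis
  moreover have "g x = g y"
    using * by (metis bidual_embed_apply)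
  ultimately show "x = y"
    by (simp add: blinfun.diff_right)
qed

lemma bidual_embed_diff: "bidual_embed (x - y) = bidual_embed x - bidual_embed y"
  by (rule blinfun_eqI) (simp add: blinfun.diff_right blinfun.diff_left)

lemma norm_bidual_embed_le: "norm (bidual_embed x) \<le> norm x"
  proof (rule norm_blinfun_bound)
  show "norm (bidual_embed x f) \<le> norm x * norm f" for f
    using norm_blinfun[of f x] by (simp add: mult.commute)
qed simp

text \<open>The embedded set is weak-star compact, being closed and inside a ball. The inverse
  embedding carries it back continuously, since the weak-star topology of the bidual induces the
  weak topology on the image of the space.\<close>

lemma compactin_weak_if_weak_star_closed:
  fixes E :: "'a::real_normed_vector set"
  assumes bnd: "bounded E" and clo: "weak_star_topology closure_of (bidual_embed ` E) \<subseteq> bidual_embed ` E"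
  shows "compactin weak_topology E"
proof -
  obtain M where M: "\<And>x. x \<in> E \<Longrightarrow> norm x \<le> M"
    using bnd by (auto simp: bounded_iff)
  have "closedin weak_star_topology (bidual_embed ` E)"
    using clo closure_of_subset[of "bidual_embed ` E" weak_star_topology] closure_of_eq by fastforce
  moreover have "bidual_embed ` E \<subseteq> cball 0 M"
    using M norm_bidual_embed_le order_trans by (fastforce simp: dist_norm)
  ultimately have cpt: "compactin weak_star_topology (bidual_embed ` E)"
    using Banach_Alaoglu closed_compactin by blast
  let ?T = "subtopology weak_star_topology (bidual_embed ` E)"
  have "continuous_map ?T weak_topology (inv bidual_embed)"
    unfolding weak_topology_def
  proof (rule continuous_map_pullback')
    have "continuous_map weak_star_topology euclidean (blinfun_apply :: (('a \<Rightarrow>\<^sub>L real) \<Rightarrow>\<^sub>L real) \<Rightarrow> _)"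
      using continuous_map_pullback[of euclidean euclidean id UNIV blinfun_apply]
      by (simp add: strong_operator_topology_def)
    then have "continuous_map ?T euclidean (blinfun_apply :: (('a \<Rightarrow>\<^sub>L real) \<Rightarrow>\<^sub>L real) \<Rightarrow> _)"
      by (rule continuous_map_from_subtopology)
    then show "continuous_map ?T euclidean ((\<lambda>x (f :: 'a \<Rightarrow>\<^sub>L real). blinfun_apply f x) \<circ> inv bidual_embed)"
    proof (rule continuous_map_eq)
      fix \<phi> assume "\<phi> \<in> topspace ?T"
      then obtain x where "\<phi> = bidual_embed x" by auto
      then show "blinfun_apply \<phi> = ((\<lambda>x (f :: 'a \<Rightarrow>\<^sub>L real). blinfun_apply f x) \<circ> inv bidual_embed) \<phi>"
        by (auto simp: inv_f_f[OF inj_bidual_embed])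
    qed
  qed auto
  moreover have "compactin ?T (bidual_embed ` E)"
    using cpt by (simp add: compactin_subtopology)
  ultimately have "compactin weak_topology (inv bidual_embed ` bidual_embed ` E)"
    by (rule image_compactin[rotated])
  then show ?thesis
    by (simp add: image_inv_f_f inj_bidual_embed)
qed

section \<open>Chebyshev radius and Chebyshev center\<close>

lemma bdd_above_norm_diff:
  assumes "bounded A"
  shows "bdd_above ((\<lambda>y. norm (x - y)) ` A)"
proof -
  obtain M where "\<And>y. y \<in> A \<Longrightarrow> norm y \<le> M"
    using assms by (auto simp: bounded_iff)
  then show ?thesis
    by (intro bdd_aboveI2[of _ _ "norm x + M"]) (meson add_left_mono norm_triangle_ineq4 order_trans)
qed

lemma chebyshev_radius_le:
  assumes "c \<in> C" "A \<noteq> {}" "bounded A" "\<And>y. y \<in> A \<Longrightarrow> norm (c - y) \<le> d"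
  shows "chebyshev_radius C A \<le> d"
proof -
  \<comment> \<open>The outer infimum is a real one, so it bounds its members only once they are
    known to be bounded below.\<close>
  have nn: "0 \<le> (SUP y\<in>A. norm (x - y))" for x
  proof -
    have "bdd_above ((\<lambda>y. norm (x - y)) ` A)"
      by (rule bdd_above_norm_diff[OF assms(3)])
    then show ?thesis
      using assms(2) by (metis cSUP_upper2 ex_in_conv norm_ge_zero)
  qed
  have "chebyshev_radius C A \<le> (SUP y\<in>A. norm (c - y))"
    unfolding chebyshev_radius_def using assms(1) nn by (intro cINF_lower bdd_belowI2)
  also have "\<dots> \<le> d"
    using assms by (intro cSUP_least)
  finally show ?thesis .
qed

text \<open>No point of \<open>C\<close> beats the radius, so an upper bound is as good as equality.
  The center becomes \<open>C\<close> cut with closed balls, from which convexity and invariance are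
  read off.\<close>

lemma chebyshev_center_iff:
  assumes "A \<noteq> {}" "bounded A"
  shows "x \<in> chebyshev_center C A \<longleftrightarrow> x \<in> C \<and> (\<forall>y\<in>A. norm (x - y) \<le> chebyshev_radius C A)"
proof -
  have bdd: "bdd_above ((\<lambda>y. norm (x - y)) ` A)"
    by (rule bdd_above_norm_diff[OF assms(2)])
  have "(SUP y\<in>A. norm (x - y)) \<le> chebyshev_radius C A \<longleftrightarrow> (\<forall>y\<in>A. norm (x - y) \<le> chebyshev_radius C A)"
    by (rule cSUP_le_iff[OF assms(1) bdd])
  moreover have "chebyshev_radius C A \<le> (SUP y\<in>A. norm (x - y))" if "x \<in> C"
    using that assms by (intro chebyshev_radius_le[of x]) (auto intro: cSUP_upper bdd)
  ultimately show ?thesis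
    unfolding chebyshev_center_def by force
qed

lemma near_chebyshev_center:
  assumes "C \<noteq> {}" "A \<noteq> {}" "bounded A" "e > 0"
  obtains x where "x \<in> C" "\<And>y. y \<in> A \<Longrightarrow> norm (x - y) \<le> chebyshev_radius C A + e"
proof -
  have bdd: "bdd_above ((\<lambda>y. norm (x - y)) ` A)" for x
    by (rule bdd_above_norm_diff[OF assms(3)])
  have "\<exists>v\<in>(\<lambda>x. SUP y\<in>A. norm (x - y)) ` C. v < chebyshev_radius C A + e"
    using assms unfolding chebyshev_radius_def by (intro cInf_lessD) auto
  then obtain x where "x \<in> C" "(SUP y\<in>A. norm (x - y)) < chebyshev_radius C A + e"
    by auto
  moreover have "norm (x - y) \<le> (SUP y\<in>A. norm (x - y))" if "y \<in> A" for y
    using that by (rule cSUP_upper) (rule bdd)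
  ultimately show thesis
    by (intro that[of x]) force+
qed

text \<open>Let \<open>bidual_embed c + \<xi>\<close> be a weak-star limit of points of
  \<open>C\<close> within \<open>r\<close> of all of \<open>A\<close>. The norm splitting gives
  \<open>norm (c - y) \<le> r - norm \<xi>\<close>, and \<open>c\<close> cannot beat the radius, so
  \<open>\<xi> = 0\<close>: such limits are centers. For limits of centers this yields compactness,
  for limits of near-centers existence.\<close>

lemma L_embedded_chebyshev_center:
  fixes C A :: "'a::banach set"
  assumes L: "L_embedded C" and bC: "bounded C" and A: "A \<noteq> {}" "bounded A"
  shows "chebyshev_center C A \<noteq> {}" "compactin weak_topology (chebyshev_center C A)"
proof -
  define r where "r = chebyshev_radius C A"
  define W :: "(('a \<Rightarrow>\<^sub>L real) \<Rightarrow>\<^sub>L real) topology" where "W = weak_star_topology"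
  have topW [simp]: "topspace W = UNIV"
    by (simp add: W_def)
  obtain Xs where Xs: "\<And>x \<xi>. \<xi> \<in> Xs \<Longrightarrow> norm (bidual_embed (x::'a) + \<xi>) = norm x + norm \<xi>"
    and cl: "W closure_of (bidual_embed ` C) \<subseteq> {bidual_embed c + \<xi> |c \<xi>. c \<in> C \<and> \<xi> \<in> Xs}"
    and C: "C \<noteq> {}"
    using L unfolding L_embedded_def W_def by blast
  have key: "\<phi> \<in> bidual_embed ` chebyshev_center C A"
    if \<phi>: "\<phi> \<in> W closure_of (bidual_embed ` C)" "\<And>y. y \<in> A \<Longrightarrow> norm (bidual_embed y - \<phi>) \<le> r" for \<phi>
  proof -
    obtain c \<xi> where c: "\<phi> = bidual_embed c + \<xi>" "c \<in> C" "\<xi> \<in> Xs"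
      using cl \<phi>(1) by auto
    have le: "norm (c - y) \<le> r - norm \<xi>" if "y \<in> A" for y
    proof -
      have "norm (c - y) + norm \<xi> = norm (bidual_embed (c - y) + \<xi>)"
        using Xs[OF c(3)] by simp
      also have "\<dots> = norm (\<phi> - bidual_embed y)"
        unfolding c(1) bidual_embed_diff by (simp add: algebra_simps)
      finally show ?thesis
        using \<phi>(2)[OF that] by (simp add: norm_minus_commute)
    qed
    have "r \<le> r - norm \<xi>"
      unfolding r_def by (rule chebyshev_radius_le[OF c(2) A le[unfolded r_def]])
    then have "\<xi> = 0"
      by simp
    then have "c \<in> chebyshev_center C A"
      unfolding chebyshev_center_iff[OF A] using c(2) le by (simp add: r_def)
    then show ?thesis
      using c(1) \<open>\<xi> = 0\<close> by simp
  qed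
  \<comment> \<open>Distance bounds survive weak-star limits because balls of the bidual are
    weak-star closed.\<close>
  have clo_in: "norm (bidual_embed y - \<phi>) \<le> d"
    if "\<phi> \<in> W closure_of (bidual_embed ` B)" "\<And>x. x \<in> B \<Longrightarrow> norm (x - y) \<le> d" for \<phi> B d and y :: 'a
  proof -
    have "bidual_embed ` B \<subseteq> cball (bidual_embed y) d"
    proof (rule image_subsetI)
      fix x assume "x \<in> B"
      have "norm (bidual_embed (x - y)) \<le> d"
        using norm_bidual_embed_le that(2)[OF \<open>x \<in> B\<close>] by (rule order_trans)
      then show "bidual_embed x \<in> cball (bidual_embed y) d"
        by (simp add: dist_norm norm_minus_commute bidual_embed_diff)
    qed
    then have "W closure_of (bidual_embed ` B) \<subseteq> cball (bidual_embed y) d"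
      unfolding W_def by (intro closure_of_minimal closedin_weak_star_cball)
    then show ?thesis
      using that(1) by (auto simp: dist_norm)
  qed
  have sub: "chebyshev_center C A \<subseteq> C"
    by (simp add: chebyshev_center_def)
  have "W closure_of (bidual_embed ` chebyshev_center C A) \<subseteq> bidual_embed ` chebyshev_center C A"
  proof
    fix \<phi> assume \<phi>: "\<phi> \<in> W closure_of (bidual_embed ` chebyshev_center C A)"
    show "\<phi> \<in> bidual_embed ` chebyshev_center C A"
    proof (rule key)
      show "\<phi> \<in> W closure_of (bidual_embed ` C)"
        by (rule subsetD[OF closure_of_mono[OF image_mono[OF sub]] \<phi>])
      show "norm (bidual_embed y - \<phi>) \<le> r" if "y \<in> A" for y
        by (rule clo_in[OF \<phi>]) (use that in \<open>simp add: chebyshev_center_iff[OF A] r_def\<close>)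
    qed
  qed
  then show "compactin weak_topology (chebyshev_center C A)"
    unfolding W_def by (rule compactin_weak_if_weak_star_closed[OF bounded_subset[OF bC sub]])
  \<comment> \<open>Near-centers: the weak-star closures of these sets are nonempty, decreasing and
    contained in one compact ball, so they have a common point.\<close>
  define B where "B n = {x \<in> C. \<forall>y\<in>A. norm (x - y) \<le> r + 1 / real (Suc n)}" for n
  obtain M where M: "\<And>x. x \<in> C \<Longrightarrow> norm x \<le> M"
    using bC by (auto simp: bounded_iff)
  have "compact_space (subtopology W (cball 0 M))"
    unfolding W_def by (intro compact_space_subtopology Banach_Alaoglu)
  then have "(\<Inter>n. W closure_of (bidual_embed ` B n)) \<noteq> {}"
  proof (rule compact_space_imp_nest)
    fix n
    have "W closure_of (bidual_embed ` B n) \<subseteq> cball 0 M"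
      unfolding W_def
    proof (intro closure_of_minimal closedin_weak_star_cball image_subsetI)
      fix x assume "x \<in> B n"
      then show "bidual_embed x \<in> cball 0 M"
        using M[of x] norm_bidual_embed_le[of x] by (auto simp: B_def)
    qed
    then show "closedin (subtopology W (cball 0 M)) (W closure_of (bidual_embed ` B n))"
      by (intro closedin_subset_topspace closedin_closure_of)
    have pos: "0 < 1 / real (Suc n)" by simp
    obtain x where "x \<in> B n"
    proof (rule near_chebyshev_center[OF C A pos])
      fix x assume "x \<in> C" "\<And>y. y \<in> A \<Longrightarrow> norm (x - y) \<le> chebyshev_radius C A + 1 / real (Suc n)"
      then have "x \<in> B n"
        unfolding B_def r_def by simp
      then show thesis by (rule that)
    qed
    then show "W closure_of (bidual_embed ` B n) \<noteq> {}"
      using closure_of_subset[of "bidual_embed ` B n" W] by auto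
  next
    have "B n \<subseteq> B m" if "m \<le> n" for m n
    proof -
      have "1 / real (Suc n) \<le> 1 / real (Suc m)"
        using that by (simp add: frac_le)
      then show ?thesis
        unfolding B_def by (auto intro: order_trans)
    qed
    then show "decseq (\<lambda>n. W closure_of (bidual_embed ` B n))"
      by (intro decseq_SucI closure_of_mono image_mono) auto
  qed
  then obtain \<phi> where \<phi>: "\<And>n. \<phi> \<in> W closure_of (bidual_embed ` B n)"
    by auto
  have "\<phi> \<in> bidual_embed ` chebyshev_center C A"
  proof (rule key)
    have "B 0 \<subseteq> C" by (auto simp: B_def)
    then show "\<phi> \<in> W closure_of (bidual_embed ` C)"
      by (rule subsetD[OF closure_of_mono[OF image_mono] \<phi>])
    fix y assume "y \<in> A"
    then have "norm (bidual_embed y - \<phi>) \<le> r + 1 / real (Suc n)" for n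
      by (intro clo_in[OF \<phi>]) (auto simp: B_def)
    moreover have "(\<lambda>n. r + 1 / real (Suc n)) \<longlonglongrightarrow> r + 0"
      by (intro tendsto_intros LIMSEQ_Suc[OF lim_1_over_n])
    ultimately show "norm (bidual_embed y - \<phi>) \<le> r"
      using LIMSEQ_le_const by fastforce
  qed
  then show "chebyshev_center C A \<noteq> {}"
    by auto
qed

lemma convex_chebyshev_center:
  assumes "convex C" "A \<noteq> {}" "bounded A"
  shows "convex (chebyshev_center C A)"
proof -
  have "chebyshev_center C A = C \<inter> (\<Inter>y\<in>A. cball y (chebyshev_radius C A))"
    by (auto simp: chebyshev_center_iff[OF assms(2,3)] dist_norm norm_minus_commute)
  then show ?thesis
    using assms(1) by (simp add: convex_Int convex_INT)
qed

section \<open>From means to invariant functionals\<close>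

text \<open>Complex values make it an argument for the mean. The formula is meaningful when
  \<open>f\<close> is bounded and continuous along the orbit, which
  \<open>apply_orbit_function\<close> derives from compactness.\<close>

definition orbit_function :: "('s::semitopological_semigroup \<Rightarrow> 'x \<Rightarrow> 'x) \<Rightarrow> 'x \<Rightarrow> ('x \<Rightarrow> real) \<Rightarrow> 's \<Rightarrow>\<^sub>C complex" where
  "orbit_function act x f = Bcontfun (\<lambda>s. complex_of_real (f (act s x)))"

lemma apply_orbit_function:
  assumes D: "continuous_dynamical_system act T" and T: "compact_space T" "x \<in> topspace T"
    and f: "continuous_map T euclideanreal f"
  shows "orbit_function act x f s = complex_of_real (f (act s x))"
proof -
  have "compactin euclideanreal (f ` topspace T)"
    by (rule image_compactin[OF T(1)[unfolded compact_space_def] f])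
  then have "bounded (f ` topspace T)"
    by (simp add: compact_imp_bounded)
  then obtain M where M: "\<And>y. y \<in> topspace T \<Longrightarrow> \<bar>f y\<bar> \<le> M"
    by (auto simp: bounded_iff)
  have in_T: "act s x \<in> topspace T" for s
    using D T(2) by (auto simp: continuous_dynamical_system_def dynamical_system_def)
  have "continuous_map euclidean T (\<lambda>s. act s x)"
    using D T(2) by (auto simp: continuous_dynamical_system_def dynamical_system_def)
  from continuous_map_compose[OF this f] have "continuous_on UNIV (\<lambda>s. f (act s x))"
    by (simp add: o_def)
  then have "continuous_on UNIV (\<lambda>s. complex_of_real (f (act s x)))"
    by (intro continuous_intros)
  moreover have "bounded (range (\<lambda>s. complex_of_real (f (act s x))))"
    using M in_T by (auto simp: bounded_iff)
  ultimately show ?thesis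
    by (simp add: orbit_function_def bcontfun_def Bcontfun_inverse)
qed

text \<open>Joint continuity enters here: by compactness and the tube lemma,
  \<open>f (act s y)\<close> is close to \<open>f (act s0 y)\<close> for \<open>s\<close> near
  \<open>s0\<close>, uniformly in \<open>y\<close>, in particular along the orbit
  \<open>y = act t x\<close>.\<close>

lemma orbit_function_in_LUC:
  assumes D: "continuous_dynamical_system act T" and T: "compact_space T" "x \<in> topspace T"
    and f: "continuous_map T euclideanreal f"
  shows "orbit_function act x f \<in> LUC"
proof -
  let ?F = "orbit_function act x f"
  let ?P = "prod_topology euclidean T"
  note app = apply_orbit_function[OF D T f]
  have in_T: "act t x \<in> topspace T" and act_mult: "act (s * t) x = act s (act t x)" for s t
    using D T(2) by (auto simp: continuous_dynamical_system_def dynamical_system_def)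
  have "((\<lambda>s. left_translate s ?F) \<longlongrightarrow> left_translate s0 ?F) (at s0)" for s0
  proof (rule tendstoI)
    fix e :: real assume e: "e > 0"
    have 1: "continuous_map ?P euclideanreal (\<lambda>z. f (act (fst z) (snd z)))"
      using continuous_map_compose[OF _ f, of ?P "\<lambda>(s, y). act s y"] D
      by (simp add: continuous_dynamical_system_def o_def case_prod_unfold)
    have "continuous_map T T (act s0)"
      using D by (auto simp: continuous_dynamical_system_def dynamical_system_def)
    then have 2: "continuous_map ?P euclideanreal (\<lambda>z. f (act s0 (snd z)))"
      using continuous_map_compose[OF continuous_map_compose[OF continuous_map_snd] f]
      by (simp add: o_def)
    \<comment> \<open>Half of \<open>e\<close> leaves room, as only a non-strict bound passes to the
      supremum norm.\<close>
    define W where "W = {z \<in> topspace ?P. f (act (fst z) (snd z)) - f (act s0 (snd z)) \<in> ball 0 (e/2)}"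
    have W: "openin ?P W"
      unfolding W_def by (rule openin_continuous_map_preimage[OF continuous_map_diff[OF 1 2]]) auto
    have sub: "{s0} \<times> topspace T \<subseteq> W"
      using e by (auto simp: W_def)
    have "compactin T (topspace T)"
      using T(1) by (simp add: compact_space_def)
    from tube_lemma_right[OF W this _ sub] obtain U V
      where U: "open U" "s0 \<in> U" "topspace T \<subseteq> V" and UV: "U \<times> V \<subseteq> W"
      by auto
    have "dist (left_translate s ?F) (left_translate s0 ?F) < e" if "s \<in> U" for s
    proof -
      have "dist (left_translate s ?F t) (left_translate s0 ?F t) \<le> e/2" for t
      proof -
        have "(s, act t x) \<in> W"
          using that in_T U(3) UV by auto
        then have "\<bar>f (act s (act t x)) - f (act s0 (act t x))\<bar> \<le> e/2"
          by (simp add: W_def)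
        then show ?thesis
          by (simp only: apply_left_translate app act_mult dist_of_real dist_real_def)
      qed
      then have "dist (left_translate s ?F) (left_translate s0 ?F) \<le> e/2"
        by (rule dist_bound)
      then show ?thesis using e by simp
    qed
    then show "\<forall>\<^sub>F s in at s0. dist (left_translate s ?F) (left_translate s0 ?F) < e"
      unfolding eventually_at_topological using U by auto
  qed
  then show ?thesis
    by (simp add: LUC_def continuous_on_def)
qed

section \<open>Means as invariant positive functionals\<close>

lemma cscale_of_real: "cscale (complex_of_real c) f = c *\<^sub>R f"
  by (rule bcontfun_eqI) (simp add: scaleR_conv_of_real)

lemma scaleR_in_LUC:
  assumes "f \<in> LUC"
  shows "c *\<^sub>R f \<in> LUC"
proof -
  have "left_translate s (c *\<^sub>R f) = c *\<^sub>R left_translate s f" for s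
    by (rule bcontfun_eqI) simp
  then show ?thesis
    using assms by (simp add: LUC_def continuous_intros)
qed

text \<open>A real supremum bounds its members only when they are bounded above, so boundedness of
  \<open>\<mu>\<close> comes in before \<open>luc_norm \<mu> = 1\<close>; rescaling to the unit ball
  does the rest.\<close>

lemma left_invariant_mean_norm_le:
  assumes \<mu>: "left_invariant_mean \<mu>" and f: "f \<in> LUC"
  shows "cmod (\<mu> f) \<le> norm f"
proof -
  from \<mu> obtain K where K: "\<And>f. f \<in> LUC \<Longrightarrow> cmod (\<mu> f) \<le> K * norm f"
    and norm1: "luc_norm \<mu> = 1"
    and scale: "\<And>c f. f \<in> LUC \<Longrightarrow> \<mu> (cscale c f) = c * \<mu> f"
    unfolding left_invariant_mean_def luc_functional_def by metis
  have "cmod (\<mu> g) \<le> \<bar>K\<bar>" if "g \<in> LUC" "norm g \<le> 1" for g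
  proof -
    have "K * norm g \<le> \<bar>K\<bar> * 1"
      using that by (intro mult_mono) auto
    with K[OF that(1)] show ?thesis by simp
  qed
  then have bdd: "bdd_above ((\<lambda>f. cmod (\<mu> f)) ` {f \<in> LUC. norm f \<le> 1})"
    by (intro bdd_aboveI2[of _ _ "\<bar>K\<bar>"]) auto
  have le1: "cmod (\<mu> g) \<le> 1" if "g \<in> LUC" "norm g \<le> 1" for g
  proof -
    have "cmod (\<mu> g) \<le> luc_norm \<mu>"
      unfolding luc_norm_def using that by (intro cSUP_upper[OF _ bdd]) auto
    then show ?thesis by (simp add: norm1)
  qed
  show ?thesis
  proof (cases "f = 0")
    case True
    then show ?thesis using K[OF f] by simp
  next
    case False
    have "cmod (\<mu> ((1 / norm f) *\<^sub>R f)) \<le> 1"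
      using False by (intro le1 scaleR_in_LUC f) auto
    moreover have "\<mu> ((1 / norm f) *\<^sub>R f) = of_real (1 / norm f) * \<mu> f"
      unfolding cscale_of_real[symmetric] by (rule scale[OF f])
    ultimately show ?thesis
      using False by (simp add: norm_mult norm_divide field_simps)
  qed
qed

text \<open>\<open>m f\<close> is the real part of \<open>\<mu>\<close> at the orbit function of one
  fixed point. By the action law, composing \<open>f\<close> with \<open>act s\<close>
  left-translates the orbit function, so invariance carries over.\<close>

lemma left_invariant_mean_imp_invariant_functional:
  fixes act :: "'s::semitopological_semigroup \<Rightarrow> 'x \<Rightarrow> 'x" and \<mu> :: "('s \<Rightarrow>\<^sub>C complex) \<Rightarrow> complex"
  assumes D: "continuous_dynamical_system act T" and T: "compact_space T" "topspace T \<noteq> {}"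
    and \<mu>: "left_invariant_mean \<mu>"
  obtains m :: "('x \<Rightarrow> real) \<Rightarrow> real" where
    "\<And>f g. continuous_map T euclideanreal f \<Longrightarrow> continuous_map T euclideanreal g \<Longrightarrow>
       m (\<lambda>x. f x + g x) = m f + m g"
    "\<And>c f. continuous_map T euclideanreal f \<Longrightarrow> m (\<lambda>x. c * f x) = c * m f"
    "\<And>f. continuous_map T euclideanreal f \<Longrightarrow> \<forall>x\<in>topspace T. f x \<ge> 0 \<Longrightarrow> m f \<ge> 0"
    "m (\<lambda>_. 1) = 1"
    "\<And>s f. continuous_map T euclideanreal f \<Longrightarrow> m (\<lambda>x. f (act s x)) = m f"
proof -
  obtain x where x: "x \<in> topspace T"
    using T(2) by blast
  define \<Phi> where "\<Phi> = orbit_function act x"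
  define m where "m f = Re (\<mu> (\<Phi> f))" for f
  have app: "\<Phi> f s = complex_of_real (f (act s x))" if "continuous_map T euclideanreal f" for f s
    unfolding \<Phi>_def by (rule apply_orbit_function[OF D T(1) x that])
  have luc: "\<Phi> f \<in> LUC" if "continuous_map T euclideanreal f" for f
    unfolding \<Phi>_def by (rule orbit_function_in_LUC[OF D T(1) x that])
  have in_T: "act t x \<in> topspace T" and act_mult: "act (s * t) x = act s (act t x)" for s t
    using D x by (auto simp: continuous_dynamical_system_def dynamical_system_def)
  have \<mu>_add: "\<mu> (f + g) = \<mu> f + \<mu> g" if "f \<in> LUC" "g \<in> LUC" for f g
    using \<mu> that by (auto simp: left_invariant_mean_def luc_functional_def)
  have \<mu>_scale: "\<mu> (cscale c f) = c * \<mu> f" if "f \<in> LUC" for c f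
    using \<mu> that by (auto simp: left_invariant_mean_def luc_functional_def)
  have add: "m (\<lambda>x. f x + g x) = m f + m g"
    if "continuous_map T euclideanreal f" "continuous_map T euclideanreal g" for f g
  proof -
    have "\<Phi> (\<lambda>x. f x + g x) = \<Phi> f + \<Phi> g"
      by (rule bcontfun_eqI) (simp add: app that continuous_map_add)
    then show ?thesis
      by (simp add: m_def \<mu>_add luc that)
  qed
  have scale: "m (\<lambda>x. c * f x) = c * m f" if "continuous_map T euclideanreal f" for c f
  proof -
    have "\<Phi> (\<lambda>x. c * f x) = cscale c (\<Phi> f)"
      by (rule bcontfun_eqI) (simp add: app that continuous_map_real_mult)
    then show ?thesis
      by (simp add: m_def \<mu>_scale luc that)
  qed
  have "\<Phi> (\<lambda>_. 1) = const_bcontfun 1"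
    by (rule bcontfun_eqI) (simp add: app const_bcontfun.rep_eq)
  then have one: "m (\<lambda>_. 1) = 1"
    using \<mu> by (simp add: m_def left_invariant_mean_def)
  have nonneg: "m f \<ge> 0"
    if f: "continuous_map T euclideanreal f" "\<And>x. x \<in> topspace T \<Longrightarrow> f x \<ge> 0" for f
  proof -
    have "compactin euclideanreal (f ` topspace T)"
      by (rule image_compactin[OF T(1)[unfolded compact_space_def] f(1)])
    then have "bounded (f ` topspace T)"
      by (simp add: compact_imp_bounded)
    then obtain M where M: "\<And>y. y \<in> topspace T \<Longrightarrow> \<bar>f y\<bar> \<le> M"
      by (auto simp: bounded_iff)
    \<comment> \<open>From \<open>0 \<le> f \<le> M\<close> follows
      \<open>\<bar>M - f\<bar> \<le> M\<close>, and norm 1 gives \<open>M - m f \<le> M\<close>. The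
      factors 1 and -1 are spelled out to fit \<open>add\<close> and \<open>scale\<close>.\<close>
    let ?g = "\<lambda>x. M * 1 + (-1) * f x"
    have cont: "continuous_map T euclideanreal (\<lambda>x. M * 1)" "continuous_map T euclideanreal (\<lambda>x. (-1) * f x)"
      "continuous_map T euclideanreal ?g"
      by (intro continuous_map_add continuous_map_real_mult continuous_map_const[THEN iffD2] f(1); simp)+
    have "norm (\<Phi> ?g s) \<le> M" for s
    proof -
      have "\<bar>M * 1 + (-1) * f (act s x)\<bar> \<le> M"
        using M[OF in_T, of s] f(2)[OF in_T, of s] by auto
      then show ?thesis
        unfolding app[OF cont(3)] norm_of_real .
    qed
    then have "norm (\<Phi> ?g) \<le> M"
      by (rule norm_bound)
    then have "m ?g \<le> M"
      using left_invariant_mean_norm_le[OF \<mu> luc[OF cont(3)]] complex_Re_le_cmod[of "\<mu> (\<Phi> ?g)"]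
      by (simp add: m_def)
    moreover have "m ?g = M * 1 + (-1) * m f"
      using add[OF cont(1,2)] scale[of "\<lambda>_. 1" M] scale[OF f(1), of "-1"] one by simp
    ultimately show ?thesis by simp
  qed
  have inv: "m (\<lambda>x. f (act s x)) = m f" if f: "continuous_map T euclideanreal f" for s f
  proof -
    have "continuous_map T T (act s)"
      using D by (auto simp: continuous_dynamical_system_def dynamical_system_def)
    from continuous_map_compose[OF this f] have "continuous_map T euclideanreal (\<lambda>x. f (act s x))"
      by (simp add: o_def)
    then have "\<Phi> (\<lambda>x. f (act s x)) = left_translate s (\<Phi> f)"
      by (intro bcontfun_eqI) (simp add: app f act_mult)
    then show ?thesis
      using \<mu> luc[OF f] by (simp add: m_def left_invariant_mean_def)
  qed
  have "m f \<ge> 0" if "continuous_map T euclideanreal f" "\<forall>x\<in>topspace T. f x \<ge> 0" for f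
    using nonneg that by blast
  with add scale one inv show thesis
    by (intro that)
qed

section \<open>Fragmentability of weakly compact sets\<close>

text \<open>These compact pieces exhaust the span of a finite \<open>X\<close> as \<open>r\<close>
  grows. Coefficients are indexed by all vectors, so that they range over a compact product of
  intervals.\<close>

lemma compact_bounded_combinations:
  fixes X :: "'a::real_normed_vector set"
  shows "compact {\<Sum>v\<in>X. u v *\<^sub>R v |u. \<forall>v. \<bar>u v\<bar> \<le> r}"
proof -
  let ?P = "\<Pi>\<^sub>E v\<in>(UNIV::'a set). {-r..r}"
  have "compactin (product_topology (\<lambda>_::'a. euclideanreal) UNIV) ?P"
    unfolding compactin_PiE by auto
  then have "compact ?P"
    by (simp add: euclidean_product_topology)
  moreover have "continuous_on ?P (\<lambda>u. \<Sum>v\<in>X. u v *\<^sub>R v)"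
    by (intro continuous_intros continuous_on_product_coordinates continuous_on_subset[OF continuous_on_product_coordinates subset_UNIV])
  ultimately have "compact ((\<lambda>u. \<Sum>v\<in>X. u v *\<^sub>R v) ` ?P)"
    by (rule compact_continuous_image[rotated])
  also have "(\<lambda>u. \<Sum>v\<in>X. u v *\<^sub>R v) ` ?P = {\<Sum>v\<in>X. u v *\<^sub>R v |u. \<forall>v. \<bar>u v\<bar> \<le> r}"
    by (auto simp: PiE_def Pi_def abs_le_iff minus_le_iff image_def)
  finally show ?thesis .
qed

lemma regular_space_shrink:
  assumes "regular_space T" "openin T U" "x \<in> U"
  obtains V where "openin T V" "x \<in> V" "T closure_of V \<subseteq> U"
proof -
  have "closedin T (topspace T - U)" "x \<in> topspace T - (topspace T - U)"
    using assms openin_subset by fastforce+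
  then obtain V W where V: "openin T V" "openin T W" "x \<in> V" "topspace T - U \<subseteq> W" "disjnt V W"
    using assms(1) unfolding regular_space_def by (metis (no_types))
  have "T closure_of V \<subseteq> topspace T - W"
    using V openin_subset[OF V(1)] by (intro closure_of_minimal) (auto simp: disjnt_def)
  then show thesis
    using V by (intro that[of V]) auto
qed

text \<open>Otherwise open sets could be shrunk away, step by step, from compact pieces exhausting the span of
  points chosen in them; a weak cluster point of these points would lie in the closed span, and yet
  at distance at least \<open>e/2\<close> from every piece.\<close>

lemma weakly_compact_fragmented:
  fixes F :: "'a::real_normed_vector set"
  assumes F: "compactin weak_topology F" "F \<noteq> {}" and e: "e > 0"
  obtains U z where "openin (subtopology weak_topology F) U" "U \<noteq> {}" "U \<subseteq> cball z e"
proof (rule ccontr)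
  assume nt: "\<not> thesis"
  note result = that
  define T where "T = subtopology weak_topology F"
  have no: "\<not> U \<subseteq> cball z e" if "openin T U" "U \<noteq> {}" for U z
    using nt result[of U z] that unfolding T_def by blast
  have T: "compact_space T" "Hausdorff_space T"
    using F(1) by (auto simp: T_def compact_space_subtopology Hausdorff_space_subtopology Hausdorff_weak_topology)
  then have reg: "regular_space T"
    by (simp add: compact_Hausdorff_imp_regular_space)
  have topT: "topspace T = F"
    by (simp add: T_def)
  have ball: "closedin T (F \<inter> cball z e)" for z
    unfolding T_def by (metis closedin_subtopology closedin_weak_cball inf_commute)
  \<comment> \<open>Balls are removed one at a time: the rest stays open because balls are weakly
    closed, and nonempty because no nonempty open set fits into a ball of radius
    \<open>e\<close>.\<close>
  have avoid: "openin T (U - (\<Union>z\<in>Z. cball z e)) \<and> U - (\<Union>z\<in>Z. cball z e) \<noteq> {}"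
    if "finite Z" "openin T U" "U \<noteq> {}" for Z U
    using that(1)
  proof induction
    case empty
    then show ?case using that by simp
  next
    case (insert z Z)
    let ?V = "U - (\<Union>z\<in>Z. cball z e)"
    have "openin T (?V - (F \<inter> cball z e))"
      by (rule openin_diff[OF conjunct1[OF insert.IH] ball])
    moreover have "?V \<subseteq> F"
      using insert.IH openin_subset topT by blast
    moreover have "\<not> ?V \<subseteq> cball z e"
      using insert.IH by (intro no) auto
    moreover have "?V - (F \<inter> cball z e) = U - (\<Union>z\<in>insert z Z. cball z e)"
      using \<open>?V \<subseteq> F\<close> by auto
    ultimately show ?case
      by auto
  qed
  \<comment> \<open>A state of the construction pairs the current open set with the finite set of
    points chosen so far; the pieces \<open>D n X\<close> eventually fill the span of all chosen
    points.\<close>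
  define D where "D n X = {\<Sum>v\<in>X. u v *\<^sub>R v |u. \<forall>v. \<bar>u v\<bar> \<le> real n}" for n :: nat and X :: "'a set"
  define P where "P n s \<longleftrightarrow> openin T (fst s) \<and> fst s \<noteq> {} \<and> finite (snd s)"
    for n :: nat and s :: "'a set \<times> 'a set"
  define Q where "Q n s t \<longleftrightarrow> T closure_of fst t \<subseteq> fst s \<and> snd s \<subseteq> snd t \<and>
      fst t \<inter> snd t \<noteq> {} \<and> (\<forall>y\<in>T closure_of fst t. \<forall>d\<in>D n (snd s). dist y d > e/2)"
    for n :: nat and s t :: "'a set \<times> 'a set"
  have "\<exists>s. \<forall>n. P n (s n) \<and> Q n (s n) (s (Suc n))"
  proof (rule dependent_nat_choice)
    have "P 0 (F, {})"
      using F(2) openin_topspace[of T] by (simp add: P_def topT)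
    then show "\<exists>s. P 0 s" ..
  next
    fix s n assume "P n s"
    then obtain U X where s: "s = (U, X)" and U: "openin T U" "U \<noteq> {}" "finite X"
      by (cases s) (auto simp: P_def)
    have "compact (D n X)"
      unfolding D_def by (rule compact_bounded_combinations)
    \<comment> \<open>Covering \<open>D n X\<close> by balls of radius \<open>e/2\<close> and then
      avoiding the concentric balls of radius \<open>e\<close> leaves a distance above
      \<open>e/2\<close>.\<close>
    then obtain Z where Z: "finite Z" "D n X \<subseteq> (\<Union>z\<in>Z. ball z (e/2))"
    proof (rule compactE_image)
      show "D n X \<subseteq> (\<Union>z\<in>UNIV. ball z (e/2))"
        using e by (metis UNIV_I UN_I centre_in_ball half_gt_zero subsetI)
    qed auto
    let ?U = "U - (\<Union>z\<in>Z. cball z e)"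
    obtain x where "x \<in> ?U"
      using avoid[OF Z(1) U(1,2)] by blast
    then obtain V where V: "openin T V" "x \<in> V" "T closure_of V \<subseteq> ?U"
      using regular_space_shrink[OF reg, of ?U x] avoid[OF Z(1) U(1,2)] by metis
    have "dist y d > e/2" if y: "y \<in> T closure_of V" and d: "d \<in> D n X" for y d
    proof -
      obtain z where "z \<in> Z" "dist z d < e/2"
        using d Z(2) by auto
      moreover have "y \<notin> cball z e"
        using y V(3) \<open>z \<in> Z\<close> by blast
      then have "dist z y > e"
        by simp
      ultimately show ?thesis
        using dist_triangle[of z y d] dist_commute[of d y] by linarith
    qed
    then have "P (Suc n) (V, insert x X) \<and> Q n s (V, insert x X)"
      using V U by (auto simp: P_def Q_def s)
    then show "\<exists>t. P (Suc n) t \<and> Q n s t" ..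
  qed
  then obtain s where s: "\<And>n. P n (s n)" "\<And>n. Q n (s n) (s (Suc n))"
    by blast
  define U where "U n = fst (s n)" for n
  define X where "X n = snd (s n)" for n
  have U: "T closure_of U (Suc n) \<subseteq> U n" "X n \<subseteq> X (Suc n)" "U (Suc n) \<inter> X (Suc n) \<noteq> {}"
      "openin T (U n)" "finite (X n)"
    and far: "\<And>y d. y \<in> T closure_of U (Suc n) \<Longrightarrow> d \<in> D n (X n) \<Longrightarrow> dist y d > e/2" for n
    using s(1)[of n] s(2)[of n] by (auto simp: P_def Q_def U_def X_def)
  have "U (Suc n) \<subseteq> U n" for n
    using U(1)[of n] closure_of_subset[OF openin_subset[OF U(4)[of "Suc n"]]] by blast
  then have decU: "U n \<subseteq> U m" if "m \<le> n" for m n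
    using that by (rule lift_Suc_antimono_le)
  have incX: "X m \<subseteq> X n" if "m \<le> n" for m n
    using U(2) that by (rule lift_Suc_mono_le)
  define B where "B = (\<Union>n. X n)"
  \<comment> \<open>Only from stage 1 on is a chosen point known to lie in the open set, hence
    \<open>Suc n\<close>.\<close>
  have "(\<Inter>n. T closure_of (B \<inter> U (Suc n))) \<noteq> {}"
  proof (rule compact_space_imp_nest[OF T(1)])
    fix n
    obtain x where "x \<in> B \<inter> U (Suc n)"
      using U(3)[of n] by (auto simp: B_def)
    moreover have "B \<inter> U (Suc n) \<subseteq> topspace T"
      using openin_subset[OF U(4)[of "Suc n"]] by auto
    ultimately show "T closure_of (B \<inter> U (Suc n)) \<noteq> {}"
      using closure_of_subset by blast
  next
    show "decseq (\<lambda>n. T closure_of (B \<inter> U (Suc n)))"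
    proof (rule decseq_SucI)
      fix n
      have "B \<inter> U (Suc (Suc n)) \<subseteq> B \<inter> U (Suc n)"
        using decU[of "Suc n" "Suc (Suc n)"] by auto
      then show "T closure_of (B \<inter> U (Suc (Suc n))) \<subseteq> T closure_of (B \<inter> U (Suc n))"
        by (rule closure_of_mono)
    qed
  qed auto
  then obtain z where z: "\<And>n. z \<in> T closure_of (B \<inter> U (Suc n))"
    by auto
  have zU: "z \<in> T closure_of U (Suc n)" for n
    by (rule subsetD[OF closure_of_mono z]) auto
  have "z \<in> T closure_of B"
    by (rule subsetD[OF closure_of_mono z[of 0]]) auto
  then have "z \<in> weak_topology closure_of B"
    unfolding T_def using closure_of_subtopology_subset by (rule subsetD[rotated])
  then have "z \<in> closure (span B)"
    using weak_closure_subset_closure_span by (rule subsetD[rotated])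
  then obtain d where d: "d \<in> span B" "dist d z < e/2"
    using e closure_approachable[of z "span B"] by (meson half_gt_zero)
  \<comment> \<open>The sets \<open>X n\<close> increase, so the finitely many vectors of a
    combination lie in a single one.\<close>
  have "\<exists>n. d \<in> span (X n)"
    using d(1)
  proof (induction rule: span_induct_alt)
    case base
    show ?case by (simp add: span_zero)
  next
    case (step c x y)
    then obtain i j where ij: "y \<in> span (X i)" "x \<in> X j"
      by (auto simp: B_def)
    then have "y \<in> span (X (max i j))" "x \<in> span (X (max i j))"
      using incX[of i "max i j"] incX[of j "max i j"] span_mono span_base
      by (meson max.cobounded1 max.cobounded2 subsetD)+
    then have "c *\<^sub>R x + y \<in> span (X (max i j))"
      by (intro span_add span_scale)
    then show ?case ..
  qed
  then obtain k where "d \<in> span (X k)" ..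
  then obtain u where u: "d = (\<Sum>v\<in>X k. u v *\<^sub>R v)"
    using span_finite[OF U(5)[of k]] by auto
  obtain N where N: "(\<Sum>v\<in>X k. \<bar>u v\<bar>) \<le> real N"
    using real_arch_simple by blast
  \<comment> \<open>One index must do two things: \<open>X n\<close> has to contain
    \<open>X k\<close>, and \<open>n\<close> has to bound the coefficients. The function
    \<open>w\<close> extends \<open>u\<close> by zero.\<close>
  define n where "n = max k N"
  define w where "w v = (if v \<in> X k then u v else 0)" for v
  have "\<bar>w v\<bar> \<le> real n" for v
  proof (cases "v \<in> X k")
    case True
    then have "\<bar>u v\<bar> \<le> (\<Sum>v\<in>X k. \<bar>u v\<bar>)"
      using U(5) by (intro member_le_sum) auto
    then show ?thesis
      using N True by (simp add: w_def n_def)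
  qed (simp add: w_def)
  moreover have "d = (\<Sum>v\<in>X n. w v *\<^sub>R v)"
    unfolding u
  proof (rule sum.mono_neutral_cong_left)
    show "X k \<subseteq> X n"
      by (rule incX) (simp add: n_def)
  qed (auto simp: U(5) w_def)
  ultimately have "d \<in> D n (X n)"
    unfolding D_def by blast
  then show False
    using far[OF zU] d(2) dist_commute[of d z] by force
qed

section \<open>Minimal systems\<close>

lemma openin_norm_gt_imp_closedin_cball:
  fixes T :: "'a::real_normed_vector topology"
  assumes "openin (prod_topology T T) {(x, y) \<in> topspace T \<times> topspace T. r < norm (x - y)}"
    and x: "x \<in> topspace T"
  shows "closedin T {y \<in> topspace T. norm (x - y) \<le> r}"
proof -
  have "continuous_map T (prod_topology T T) (\<lambda>y. (x, y))"
    using x by (simp add: continuous_map_paired)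
  from openin_continuous_map_preimage[OF this assms(1)]
  have "openin T {y \<in> topspace T. r < norm (x - y)}"
    using x by (simp add: conj_commute cong: conj_cong)
  moreover have "topspace T - {y \<in> topspace T. norm (x - y) \<le> r} = {y \<in> topspace T. r < norm (x - y)}"
    by auto
  ultimately show ?thesis
    by (simp add: closedin_def)
qed

text \<open>\<open>m\<close> plays the role of integration against an invariant probability measure;
  only its values on continuous functions matter.\<close>

locale minimal_system =
  fixes T :: "'x topology" and act :: "'s \<Rightarrow> 'x \<Rightarrow> 'x" and m :: "('x \<Rightarrow> real) \<Rightarrow> real"
  assumes compact: "compact_space T" and Hausdorff: "Hausdorff_space T" and nonempty: "topspace T \<noteq> {}"
    and act_continuous: "continuous_map T T (act s)"
    and minimal: "closedin T G \<Longrightarrow> G \<noteq> {} \<Longrightarrow> (\<And>s. act s ` G \<subseteq> G) \<Longrightarrow> G = topspace T"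
    and add: "continuous_map T euclideanreal f \<Longrightarrow> continuous_map T euclideanreal g \<Longrightarrow>
       m (\<lambda>x. f x + g x) = m f + m g"
    and scale: "continuous_map T euclideanreal f \<Longrightarrow> m (\<lambda>x. c * f x) = c * m f"
    and nonneg: "continuous_map T euclideanreal f \<Longrightarrow> (\<And>x. x \<in> topspace T \<Longrightarrow> f x \<ge> 0) \<Longrightarrow> m f \<ge> 0"
    and one: "m (\<lambda>_. 1) = 1"
    and invariant: "continuous_map T euclideanreal f \<Longrightarrow> m (\<lambda>x. f (act s x)) = m f"
begin

lemma act_in: "x \<in> topspace T \<Longrightarrow> act s x \<in> topspace T"
  using continuous_map_image_subset_topspace[OF act_continuous] by blast

lemma normal: "normal_space T"
  using compact_Hausdorff_or_regular_imp_normal_space compact Hausdorff by blast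

lemma continuous_act: "continuous_map T euclideanreal f \<Longrightarrow> continuous_map T euclideanreal (\<lambda>x. f (act s x))"
  using continuous_map_compose[OF act_continuous] by (simp add: o_def)

lemma mono:
  assumes f: "continuous_map T euclideanreal f" and g: "continuous_map T euclideanreal g"
    and le: "\<And>x. x \<in> topspace T \<Longrightarrow> f x \<le> g x"
  shows "m f \<le> m g"
proof -
  have c: "continuous_map T euclideanreal (\<lambda>x. g x - f x)"
    by (intro continuous_map_diff f g)
  have "m g = m f + m (\<lambda>x. g x - f x)"
    using add[OF f c] by simp
  with nonneg[OF c] le show ?thesis by simp
qed

text \<open>The invariant measure has full support. The common zero set \<open>G\<close> of the
  nonnegative functions of mass zero is closed, and invariant because \<open>m\<close> is. By
  compactness it is nonempty, so minimality makes it the whole space.\<close>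

lemma positive:
  assumes f: "continuous_map T euclideanreal f" "\<And>x. x \<in> topspace T \<Longrightarrow> f x \<ge> 0"
    and x: "x \<in> topspace T" "f x > 0"
  shows "m f > 0"
proof -
  define N where "N = {f. continuous_map T euclideanreal f \<and> (\<forall>x\<in>topspace T. f x \<ge> 0) \<and> m f = 0}"
  define pos where "pos f = {x \<in> topspace T. f x \<in> {0<..}}" for f :: "'x \<Rightarrow> real"
  define G where "G = topspace T - (\<Union>f\<in>N. pos f)"
  have op: "openin T (pos f)" if "f \<in> N" for f
    unfolding pos_def using that by (intro openin_continuous_map_preimage) (auto simp: N_def)
  then have "closedin T G"
    unfolding G_def by (intro closedin_diff) auto
  moreover have "act s ` G \<subseteq> G" for s
  proof (intro image_subsetI)
    fix x assume x: "x \<in> G"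
    have "act s x \<notin> pos f" if f: "f \<in> N" for f
    proof -
      have "(\<lambda>x. f (act s x)) \<in> N"
        using f act_in by (auto simp: N_def invariant continuous_act)
      then have "x \<notin> pos (\<lambda>x. f (act s x))"
        using x by (auto simp: G_def)
      then show ?thesis
        using x by (auto simp: G_def pos_def)
    qed
    then show "act s x \<in> G"
      using x act_in by (auto simp: G_def)
  qed
  moreover have "G \<noteq> {}"
  proof
    assume "G = {}"
    then have cover: "topspace T \<subseteq> \<Union>(pos ` N)"
      by (auto simp: G_def)
    have "compactin T (topspace T)"
      using compact by (simp add: compact_space_def)
    then obtain \<F> where \<F>: "finite \<F>" "\<F> \<subseteq> pos ` N" "topspace T \<subseteq> \<Union>\<F>"
      using cover op unfolding compactin_def by (metis (no_types, lifting) imageE)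
    then obtain M where M: "finite M" "M \<subseteq> N" "\<F> = pos ` M"
      by (meson finite_subset_image)
    have "\<exists>g\<in>N. \<Union>(pos ` M) \<subseteq> pos g"
      using M(1,2)
    proof induction
      case empty
      have "(\<lambda>x. 0 * 1) \<in> N"
        using scale[of "\<lambda>_. 1" 0] by (simp add: N_def)
      then show ?case by blast
    next
      case (insert f M)
      then obtain g where g: "g \<in> N" "\<Union>(pos ` M) \<subseteq> pos g" and f: "f \<in> N"
        by auto
      have "(\<lambda>x. f x + g x) \<in> N"
        using f g(1) by (auto simp: N_def add continuous_map_add)
      moreover have "pos f \<subseteq> pos (\<lambda>x. f x + g x)" "pos g \<subseteq> pos (\<lambda>x. f x + g x)"
        using f g(1) by (auto simp: N_def pos_def add_pos_nonneg add_nonneg_pos)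
      ultimately show ?case
        using g(2) by (intro bexI[of _ "\<lambda>x. f x + g x"]) auto
    qed
    then obtain g where g: "g \<in> N" "\<Union>(pos ` M) \<subseteq> pos g"
      by (elim bexE)
    have gpos: "topspace T \<subseteq> pos g"
      using \<F>(3) g(2) unfolding M(3) by (rule order_trans)
    have cont: "continuous_map T euclideanreal g"
      using g by (simp add: N_def)
    have "compactin euclideanreal (g ` topspace T)"
      by (rule image_compactin[OF \<open>compactin T (topspace T)\<close> cont])
    then have "compact (g ` topspace T)"
      by simp
    \<comment> \<open>A finite sum \<open>g\<close> of null functions is positive everywhere; its
      minimum is positive and at most \<open>m g = 0\<close>.\<close>
    then obtain y where y: "y \<in> topspace T" "\<And>x. x \<in> topspace T \<Longrightarrow> g y \<le> g x"
      using compact_attains_inf[of "g ` topspace T"] nonempty by auto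
    have "m (\<lambda>x. g y * 1) \<le> m g"
      using y(2) by (intro mono cont) auto
    then have "g y \<le> m g"
      using scale[of "\<lambda>_. 1" "g y"] one by simp
    then show False
      using g(1) gpos y(1) by (auto simp: N_def pos_def)
  qed
  ultimately have "G = topspace T"
    by (intro minimal)
  then have "x \<notin> pos f" if "f \<in> N" for f
    using x that by (auto simp: G_def)
  then have "f \<notin> N"
    using x by (auto simp: pos_def)
  then have "m f \<noteq> 0"
    using f by (auto simp: N_def)
  then show ?thesis
    using nonneg[OF f] by simp
qed

lemma separating_function:
  assumes "closedin T A" "closedin T B" "A \<inter> B = {}"
  obtains h where "continuous_map T euclideanreal h" "\<And>x. x \<in> topspace T \<Longrightarrow> 0 \<le> h x \<and> h x \<le> 1"
    "\<And>x. x \<in> A \<Longrightarrow> h x = 1" "\<And>x. x \<in> B \<Longrightarrow> h x = 0"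
proof -
  obtain h where h: "continuous_map T (top_of_set {0..1::real}) h" "h ` B \<subseteq> {0}" "h ` A \<subseteq> {1}"
    using Urysohn_lemma[of T B A 0 1] normal assms by (auto simp: disjnt_def)
  show thesis
  proof (rule that[of h])
    show "continuous_map T euclideanreal h"
      using h(1) by (simp add: continuous_map_in_subtopology)
    show "0 \<le> h x \<and> h x \<le> 1" if "x \<in> topspace T" for x
      using h(1) that by (auto simp: continuous_map_in_subtopology)
  qed (use h in auto)
qed

text \<open>A function equal to 1 at a missed point and 0 on the closed image of
  \<open>act s\<close> composes with \<open>act s\<close> to zero, so invariance gives it mass zero,
  against full support.\<close>

lemma act_surj: "act s ` topspace T = topspace T"
proof (rule ccontr)
  assume "act s ` topspace T \<noteq> topspace T"
  then obtain z where z: "z \<in> topspace T" "z \<notin> act s ` topspace T"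
    using act_in by blast
  have "compactin T (act s ` topspace T)"
    using compact act_continuous unfolding compact_space_def by (rule image_compactin)
  then have "closedin T (act s ` topspace T)"
    by (rule compactin_imp_closedin[OF Hausdorff])
  moreover have "closedin T {z}"
    using Hausdorff z(1) by (simp add: closedin_Hausdorff_sing_eq)
  ultimately obtain h where h: "continuous_map T euclideanreal h" "\<And>x. x \<in> topspace T \<Longrightarrow> 0 \<le> h x \<and> h x \<le> 1"
    "h z = 1" "\<And>x. x \<in> act s ` topspace T \<Longrightarrow> h x = 0"
    using separating_function[of "{z}" "act s ` topspace T"] z(2) by (metis Int_insert_left_if0 inf_bot_left singletonI)
  have "0 < m h"
    using h z(1) by (intro positive[of h z]) auto
  also have "m h = m (\<lambda>x. h (act s x))"
    by (rule invariant[symmetric, OF h(1)])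
  also have "\<dots> \<le> m (\<lambda>x. 0 * 1)"
    by (rule mono[OF continuous_act[OF h(1)]]) (simp_all add: h(4))
  also have "\<dots> = 0"
    using scale[of "\<lambda>_. 1" 0] by simp
  finally show False by simp
qed

end

text \<open>The openness assumption is joint lower semicontinuity of the norm distance for
  \<open>T\<close>, as in the weak topology.\<close>

locale minimal_nonexpansive_system = minimal_system T act m
  for T :: "'a::real_normed_vector topology" and act :: "'s \<Rightarrow> 'a \<Rightarrow> 'a" and m +
  assumes nonexpansive: "x \<in> topspace T \<Longrightarrow> y \<in> topspace T \<Longrightarrow> norm (act s x - act s y) \<le> norm (x - y)"
    and openin_norm_gt: "openin (prod_topology T T) {(x, y) \<in> topspace T \<times> topspace T. r < norm (x - y)}"
begin

text \<open>Continuous majorants of the indicator of a closed ball: the infimum of their masses is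
  the outer measure of the ball.\<close>

definition ball_majorant :: "real \<Rightarrow> 'a \<Rightarrow> ('a \<Rightarrow> real) \<Rightarrow> bool" where
  "ball_majorant r x f \<longleftrightarrow> continuous_map T euclideanreal f \<and> (\<forall>y\<in>topspace T. 0 \<le> f y) \<and>
     (\<forall>y\<in>topspace T. norm (x - y) \<le> r \<longrightarrow> 1 \<le> f y)"

text \<open>The outer measure of the balls of a fixed radius is upper semicontinuous and does not decrease
  along orbits, so by minimality one positive lower bound holds for all centers.\<close>

lemma ball_mass_lower_bound:
  assumes U: "openin T U" "x \<in> U" "\<And>y. y \<in> U \<Longrightarrow> norm (x - y) \<le> r"
  obtains c where "c > 0" "\<And>x f. x \<in> topspace T \<Longrightarrow> ball_majorant r x f \<Longrightarrow> c \<le> m f"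
proof -
  have x: "x \<in> topspace T"
    using U openin_subset by blast
  obtain h where h: "continuous_map T euclideanreal h" "\<And>x. x \<in> topspace T \<Longrightarrow> 0 \<le> h x \<and> h x \<le> 1"
    "h x = 1" "\<And>y. y \<in> topspace T - U \<Longrightarrow> h y = 0"
  proof (rule separating_function[of "{x}" "topspace T - U"])
    show "closedin T {x}"
      using Hausdorff x by (simp add: closedin_Hausdorff_sing_eq)
  qed (use U in auto)
  \<comment> \<open>\<open>h\<close> is at most 1 and vanishes off \<open>U\<close>, so it lies
    below every majorant for the ball about \<open>x\<close>.\<close>
  define c where "c = m h"
  have c: "c > 0"
    unfolding c_def using h x by (intro positive[of h x]) auto
  define G where "G = {x \<in> topspace T. \<forall>f. ball_majorant r x f \<longrightarrow> c \<le> m f}"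
  have "\<exists>V. openin T V \<and> z \<in> V \<and> V \<subseteq> topspace T - G" if z: "z \<in> topspace T - G" for z
  proof -
    obtain f where f: "ball_majorant r z f" "m f < c"
      using z by (auto simp: G_def not_le)
    have fc: "continuous_map T euclideanreal f" "\<And>y. y \<in> topspace T \<Longrightarrow> 0 \<le> f y"
      using f(1) by (auto simp: ball_majorant_def)
    \<comment> \<open>As \<open>m f < c\<close>, the majorant can be enlarged by a factor
      \<open>b > 1\<close> with mass still below \<open>c\<close>. If \<open>m f = 0\<close> any
      factor works, and 2 is taken; \<open>b\<close> lies midway between 1 and \<open>a\<close> to
      keep the inequality strict.\<close>
    define a where "a = (if m f = 0 then 2 else c / m f)"
    have a: "a > 1" "a * m f \<le> c"
      using f(2) c nonneg[OF fc] by (auto simp: a_def field_simps)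
    define b where "b = (1 + a) / 2"
    have b: "1 < b" "b < a"
      using a(1) by (auto simp: b_def)
    have bm: "b * m f < c"
    proof (cases "m f = 0")
      case False
      then have "b * m f < a * m f"
        using b nonneg[OF fc] by (intro mult_strict_right_mono) auto
      then show ?thesis using a(2) by simp
    qed (use c in simp)
    \<comment> \<open>Where \<open>b * f y \<le> 1\<close>, the point \<open>y\<close> is farther
      than \<open>r\<close> from \<open>z\<close>. By the tube lemma this persists for centers
      \<open>v\<close> near \<open>z\<close>, so \<open>b * f\<close> is a majorant for them
      too.\<close>
    define L where "L = {y \<in> topspace T. f y \<in> {..1/b}}"
    have "closedin T L"
      unfolding L_def by (rule closedin_continuous_map_preimage[OF fc(1)]) simp
    then have "compactin T L"
      using compact by (simp add: closedin_compact_space)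
    moreover have "{z} \<times> L \<subseteq> {(x, y) \<in> topspace T \<times> topspace T. r < norm (x - y)}"
    proof -
      have "r < norm (z - y)" if "y \<in> L" for y
      proof (rule ccontr)
        assume "\<not> r < norm (z - y)"
        then have "1 \<le> f y"
          using that f(1) by (auto simp: L_def ball_majorant_def)
        moreover have "1 / b < 1"
          using b by simp
        ultimately show False
          using that by (auto simp: L_def)
      qed
      then show ?thesis
        using z by (auto simp: L_def)
    qed
    ultimately obtain V W where V: "openin T V" "z \<in> V" "L \<subseteq> W"
      "V \<times> W \<subseteq> {(x, y) \<in> topspace T \<times> topspace T. r < norm (x - y)}"
      using tube_lemma_right[OF openin_norm_gt[of r], of L z] z by auto
    have "v \<in> topspace T - G" if v: "v \<in> V" for v
    proof -
      have "1 \<le> b * f y" if y: "y \<in> topspace T" "norm (v - y) \<le> r" for y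
      proof -
        have "y \<notin> L"
          using y(2) V(3,4) v by force
        then have "1 / b < f y"
          using y by (auto simp: L_def)
        then show ?thesis
          using b by (simp add: field_simps)
      qed
      then have "ball_majorant r v (\<lambda>y. b * f y)"
        using fc b by (auto simp: ball_majorant_def intro!: continuous_map_real_mult)
      moreover have "m (\<lambda>y. b * f y) < c"
        using bm scale[OF fc(1)] by simp
      moreover have "v \<in> topspace T"
        using v V(1) openin_subset by blast
      ultimately show ?thesis
        by (auto simp: G_def not_le)
    qed
    with V show ?thesis by blast
  qed
  then have "openin T (topspace T - G)"
    by (subst openin_subopen) blast
  moreover have "G \<subseteq> topspace T"
    by (auto simp: G_def)
  ultimately have "closedin T G"
    by (simp add: closedin_def)
  moreover have "act s ` G \<subseteq> G" for s
  proof (intro image_subsetI)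
    fix z assume z: "z \<in> G"
    then have zT: "z \<in> topspace T"
      by (simp add: G_def)
    have "c \<le> m f" if f: "ball_majorant r (act s z) f" for f
    proof -
      \<comment> \<open>Nonexpansiveness sends the ball about \<open>z\<close> into the ball about
        \<open>act s z\<close>, so majorants pull back with unchanged mass.\<close>
      have "ball_majorant r z (\<lambda>y. f (act s y))"
        unfolding ball_majorant_def
      proof (intro conjI ballI impI)
        fix y assume y: "y \<in> topspace T" "norm (z - y) \<le> r"
        then have "norm (act s z - act s y) \<le> r"
          using nonexpansive[OF zT y(1), of s] by simp
        then show "1 \<le> f (act s y)"
          using f act_in[OF y(1)] by (simp add: ball_majorant_def)
      qed (use f act_in continuous_act in \<open>auto simp: ball_majorant_def\<close>)
      then have "c \<le> m (\<lambda>y. f (act s y))"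
        using z by (simp add: G_def)
      then show ?thesis
        using invariant[of f s] f by (simp add: ball_majorant_def)
    qed
    then show "act s z \<in> G"
      using act_in[OF zT] by (simp add: G_def)
  qed
  moreover have "x \<in> G"
  proof -
    have "c \<le> m f" if f: "ball_majorant r x f" for f
      unfolding c_def
    proof (rule mono)
      fix y assume y: "y \<in> topspace T"
      show "h y \<le> f y"
        using h(2,4)[of y] f U(3)[of y] y by (cases "y \<in> U") (force simp: ball_majorant_def)+
    qed (use h f in \<open>auto simp: ball_majorant_def\<close>)
    then show ?thesis
      using x by (simp add: G_def)
  qed
  ultimately have "G = topspace T"
    by (intro minimal) auto
  then show thesis
    using c by (intro that[of c]) (auto simp: G_def)
qed

text \<open>The balls are disjoint, so their masses add up. A Urysohn function \<open>h\<close>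
  splits \<open>f\<close> into \<open>h * f\<close>, a majorant for the ball about \<open>x\<close>,
  and \<open>(1 - h) * f\<close>, which dominates the others and feeds the induction.\<close>

lemma separated_points_mass:
  assumes c: "\<And>x f. x \<in> topspace T \<Longrightarrow> ball_majorant r x f \<Longrightarrow> c \<le> m f"
    and N: "finite N" "N \<subseteq> topspace T" "\<And>x y. x \<in> N \<Longrightarrow> y \<in> N \<Longrightarrow> x \<noteq> y \<Longrightarrow> 2 * r < norm (x - y)"
    and f: "continuous_map T euclideanreal f" "\<And>y. y \<in> topspace T \<Longrightarrow> 0 \<le> f y"
      "\<And>x y. x \<in> N \<Longrightarrow> y \<in> topspace T \<Longrightarrow> norm (x - y) \<le> r \<Longrightarrow> 1 \<le> f y"
  shows "c * card N \<le> m f"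
  using N f
proof (induction N arbitrary: f rule: finite_induct)
  case empty
  then show ?case by (simp add: nonneg)
next
  case (insert x N)
  define B where "B z = {y \<in> topspace T. norm (z - y) \<le> r}" for z
  have B: "closedin T (B z)" if "z \<in> topspace T" for z
    unfolding B_def by (rule openin_norm_gt_imp_closedin_cball[OF openin_norm_gt that])
  have "B x \<inter> B z = {}" if "z \<in> N" for z
  proof -
    have "2 * r < norm (x - z)"
      using insert.prems(2)[of x z] insert.hyps(2) that by auto
    then have "\<not> (norm (x - y) \<le> r \<and> norm (z - y) \<le> r)" for y
      using norm_triangle_ineq4[of "x - y" "z - y"] by (auto simp: norm_minus_commute)
    then show ?thesis
      by (auto simp: B_def)
  qed
  then have disj: "B x \<inter> (\<Union>z\<in>N. B z) = {}"
    by auto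
  have "closedin T (B x)" "closedin T (\<Union>z\<in>N. B z)"
    using insert by (auto intro!: B closedin_Union)
  from separating_function[OF this disj] obtain h
    where h: "continuous_map T euclideanreal h" "\<And>x. x \<in> topspace T \<Longrightarrow> 0 \<le> h x \<and> h x \<le> 1"
      "\<And>y. y \<in> B x \<Longrightarrow> h y = 1" "\<And>y. y \<in> (\<Union>z\<in>N. B z) \<Longrightarrow> h y = 0"
    by metis
  note f = insert.prems(3-5)
  have cont: "continuous_map T euclideanreal (\<lambda>y. h y * f y)"
    "continuous_map T euclideanreal (\<lambda>y. (1 - h y) * f y)"
    by (intro continuous_map_real_mult continuous_map_diff h f continuous_map_const[THEN iffD2]; simp)+
  have "m f = m (\<lambda>y. h y * f y) + m (\<lambda>y. (1 - h y) * f y)"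
    using add[OF cont] by (simp add: algebra_simps)
  moreover have "c \<le> m (\<lambda>y. h y * f y)"
  proof (rule c)
    show "x \<in> topspace T"
      using insert.prems(1) by simp
    show "ball_majorant r x (\<lambda>y. h y * f y)"
      using cont h(2,3) f(2) f(3)[of x] by (auto simp: ball_majorant_def B_def)
  qed
  moreover have "c * card N \<le> m (\<lambda>y. (1 - h y) * f y)"
  proof (rule insert.IH[OF _ _ cont(2)])
    show "0 \<le> (1 - h y) * f y" if "y \<in> topspace T" for y
      using h(2) f(2) that by simp
    show "1 \<le> (1 - h y) * f y" if "z \<in> N" "y \<in> topspace T" "norm (z - y) \<le> r" for z y
    proof -
      have "h y = 0"
        using that by (intro h(4)) (auto simp: B_def)
      then show ?thesis
        using f(3)[of z y] that by simp
    qed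
  qed (use insert.prems in auto)
  ultimately show ?case
    using insert.hyps by (simp add: algebra_simps)
qed

text \<open>A \<open>2 * r\<close>-separated set of greatest cardinality is a net, since any point
  far from it could be added.\<close>

lemma finite_net:
  assumes U: "openin T U" "U \<noteq> {}" "U \<subseteq> cball z (r / 2)"
  obtains N where "finite N" "N \<noteq> {}" "N \<subseteq> topspace T" "\<And>y. y \<in> topspace T \<Longrightarrow> \<exists>x\<in>N. norm (x - y) \<le> 2 * r"
proof -
  obtain x where x: "x \<in> U"
    using U by auto
  have r: "0 \<le> r"
  proof -
    have "dist z x \<le> r / 2"
      using x U(3) by auto
    then show ?thesis
      using zero_le_dist[of z x] by linarith
  qed
  have "norm (x - y) \<le> r" if "y \<in> U" for y
  proof -
    have "dist z x \<le> r / 2" "dist z y \<le> r / 2"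
      using x that U(3) by auto
    then show ?thesis
      using dist_triangle3[of x y z] by (simp add: dist_norm)
  qed
  from ball_mass_lower_bound[OF U(1) x this] obtain c
    where c: "c > 0" "\<And>x f. x \<in> topspace T \<Longrightarrow> ball_majorant r x f \<Longrightarrow> c \<le> m f"
    by metis
  define P where "P N \<longleftrightarrow> finite N \<and> N \<subseteq> topspace T \<and> (\<forall>x\<in>N. \<forall>y\<in>N. x \<noteq> y \<longrightarrow> 2 * r < norm (x - y))" for N
  \<comment> \<open>The constant 1 is a majorant for all balls at once and has mass 1.\<close>
  have "card N < nat \<lceil>1 / c\<rceil> + 1" if "P N" for N
  proof -
    have "c * card N \<le> m (\<lambda>_. 1)"
      using that c(2) by (intro separated_points_mass[of r]) (auto simp: P_def)
    then have "real (card N) \<le> 1 / c"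
      using c(1) by (simp add: one field_simps)
    then show ?thesis by linarith
  qed
  moreover have "P {}"
    by (simp add: P_def)
  ultimately obtain N where N: "P N" "\<And>M. P M \<Longrightarrow> card M \<le> card N"
    using ex_has_greatest_nat[of P "{}" card] by metis
  have net: "\<exists>x\<in>N. norm (x - y) \<le> 2 * r" if y: "y \<in> topspace T" for y
  proof (rule ccontr)
    assume "\<not> ?thesis"
    then have far: "\<And>x. x \<in> N \<Longrightarrow> 2 * r < norm (x - y)"
      by force
    then have "y \<notin> N"
      using r by force
    have "P (insert y N)"
      using N(1) y far by (auto simp: P_def norm_minus_commute)
    from N(2)[OF this] show False
      using N(1) \<open>y \<notin> N\<close> by (simp add: P_def)
  qed
  moreover have "N \<noteq> {}"
    using net nonempty by blast
  ultimately show thesis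
    using N(1) by (intro that[of N]) (auto simp: P_def)
qed

end

section \<open>Common fixed points\<close>

text \<open>Zorn's lemma with the finite intersection property. The property \<open>P\<close> is a
  parameter because two kinds of minimal sets are taken: convex invariant ones, then merely
  invariant ones.\<close>

lemma minimal_compact_subset:
  assumes X: "Hausdorff_space X" and E: "compactin X E" "E \<noteq> {}" "P E"
    and Inter: "\<And>\<C>. \<C> \<noteq> {} \<Longrightarrow> (\<And>K. K \<in> \<C> \<Longrightarrow> P K) \<Longrightarrow> P (\<Inter>\<C>)"
  shows "\<exists>K\<subseteq>E. compactin X K \<and> K \<noteq> {} \<and> P K \<and>
    (\<forall>K'\<subseteq>K. compactin X K' \<longrightarrow> K' \<noteq> {} \<longrightarrow> P K' \<longrightarrow> K' = K)"
proof -
  define \<A> where "\<A> = {K. K \<subseteq> E \<and> compactin X K \<and> K \<noteq> {} \<and> P K}"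
  have "\<exists>K\<in>\<A>. \<forall>K'\<in>\<A>. K \<supseteq> K' \<longrightarrow> K' = K"
  proof (rule predicate_Zorn)
    show "partial_order_on \<A> (relation_of (\<lambda>K K'. K \<supseteq> K') \<A>)"
      by (auto simp: partial_order_on_def preorder_on_def refl_on_def relation_of_def
          intro!: transI antisymI)
  next
    fix \<C> assume "\<C> \<in> Chains (relation_of (\<lambda>K K'. K \<supseteq> K') \<A>)"
    then have sub: "\<C> \<subseteq> \<A>" and lin: "\<And>K L. K \<in> \<C> \<Longrightarrow> L \<in> \<C> \<Longrightarrow> K \<subseteq> L \<or> L \<subseteq> K"
      by (auto simp: Chains_def relation_of_def)
    show "\<exists>u\<in>\<A>. \<forall>K\<in>\<C>. K \<supseteq> u"
    proof (cases "\<C> = {}")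
      case True
      have "E \<in> \<A>"
        using E by (auto simp: \<A>_def)
      then show ?thesis using True by auto
    next
      case False
      have clo: "closedin X K" "K \<subseteq> E" "K \<noteq> {}" "P K" if "K \<in> \<C>" for K
        using that sub compactin_imp_closedin[OF X] by (auto simp: \<A>_def)
      have "closedin (subtopology X E) K" if "K \<in> \<C>" for K
        using clo[OF that] by (intro closedin_subset_topspace)
      moreover have "\<Inter>\<F> \<noteq> {}" if \<F>: "finite \<F>" "\<F> \<subseteq> \<C>" for \<F>
      proof (cases "\<F> = {}")
        case False
        have "subset.chain \<A> \<F>"
          using \<F> sub lin unfolding subset_chain_def by blast
        \<comment> \<open>A finite nonempty part of a chain has a least member, which is
          nonempty.\<close>
        then have "\<Inter>\<F> \<in> \<F>"
          using \<F>(1) False by (intro Inter_in_chain)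
        then show ?thesis
          using clo(3) \<F>(2) by blast
      qed simp
      ultimately have "\<Inter>\<C> \<noteq> {}"
        using compact_space_subtopology[OF E(1)] unfolding compact_space_fip by metis
      moreover have "\<Inter>\<C> \<subseteq> E"
        using False clo(2) by blast
      moreover have "closedin X (\<Inter>\<C>)"
        using False clo(1) by (intro closedin_Inter)
      then have "compactin X (\<Inter>\<C>)"
        by (rule closed_compactin[OF E(1) \<open>\<Inter>\<C> \<subseteq> E\<close>])
      moreover have "P (\<Inter>\<C>)"
        using False clo(4) by (intro Inter)
      ultimately have "\<Inter>\<C> \<in> \<A>"
        by (simp add: \<A>_def)
      then show ?thesis by (rule bexI[rotated]) auto
    qed
  qed
  then obtain K where K: "K \<in> \<A>" "\<And>K'. K' \<in> \<A> \<Longrightarrow> K' \<subseteq> K \<Longrightarrow> K' = K"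
    by blast
  show ?thesis
  proof (intro exI[of _ K] conjI allI impI)
    fix K' assume "K' \<subseteq> K" "compactin X K'" "K' \<noteq> {}" "P K'"
    then show "K' = K"
      using K(1) by (intro K(2)) (auto simp: \<A>_def)
  qed (use K(1) in \<open>auto simp: \<A>_def\<close>)
qed

lemma continuous_dynamical_system_subtopology:
  assumes D: "continuous_dynamical_system act T" and F: "F \<subseteq> topspace T" "\<And>s. act s ` F \<subseteq> F"
  shows "continuous_dynamical_system act (subtopology T F)"
proof -
  have top: "topspace (subtopology T F) = F"
    using F(1) by auto
  have "continuous_map (subtopology (prod_topology euclidean T) (UNIV \<times> F)) T (\<lambda>(s, x). act s x)"
    using D by (intro continuous_map_from_subtopology) (simp add: continuous_dynamical_system_def)
  then have joint: "continuous_map (prod_topology euclidean (subtopology T F)) T (\<lambda>(s, x). act s x)"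
    by (simp add: subtopology_Times)
  have "continuous_map (subtopology T F) T (act s)" for s
    using D by (intro continuous_map_from_subtopology)
      (simp add: continuous_dynamical_system_def dynamical_system_def)
  moreover have "continuous_map euclidean T (\<lambda>s. act s x)" if "x \<in> F" for x
    using D F(1) that by (auto simp: continuous_dynamical_system_def dynamical_system_def)
  moreover have "act s (act t x) = act (s * t) x" if "x \<in> F" for s t x
    using D F(1) that by (auto simp: continuous_dynamical_system_def dynamical_system_def)
  ultimately show ?thesis
    using joint F(2)
    unfolding continuous_dynamical_system_def dynamical_system_def top continuous_map_in_subtopology
    by (auto simp: image_subset_iff)
qed

text \<open>One summand of the average is at most \<open>d / 2\<close> instead of \<open>d\<close>,
  which saves \<open>d / 2\<close> divided by the number of summands.\<close>

lemma norm_mean_diff_le: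
  fixes N :: "'a::real_normed_vector set"
  assumes N: "finite N" "x \<in> N" and d: "\<And>x. x \<in> N \<Longrightarrow> norm (x - y) \<le> d" and x: "norm (x - y) \<le> d / 2"
  shows "norm ((\<Sum>x\<in>N. (1 / card N) *\<^sub>R x) - y) \<le> d - d / (2 * card N)"
proof -
  have n: "card N > 0"
    using N card_gt_0_iff by blast
  have "(\<Sum>x\<in>N. (1 / card N) *\<^sub>R x) - y = (\<Sum>x\<in>N. (1 / card N) *\<^sub>R (x - y))"
    using n by (simp add: scaleR_diff_right sum_subtractf scaleR_sum_left[symmetric] sum_constant_scaleR)
  also have "norm \<dots> \<le> (\<Sum>x\<in>N. norm ((1 / card N) *\<^sub>R (x - y)))"
    by (rule norm_sum)
  also have "\<dots> = (1 / card N) * (\<Sum>x\<in>N. norm (x - y))"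
    by (simp add: sum_divide_distrib)
  also have "(\<Sum>x\<in>N. norm (x - y)) = norm (x - y) + (\<Sum>x\<in>N - {x}. norm (x - y))"
    using N by (simp add: sum.remove)
  also have "\<dots> \<le> d / 2 + (real (card N) - 1) * d"
  proof -
    have "(\<Sum>x\<in>N - {x}. norm (x - y)) \<le> of_nat (card (N - {x})) * d"
      using d by (intro sum_bounded_above) auto
    also have "real (card (N - {x})) = real (card N) - 1"
      using N n by (simp add: card_Diff_singleton of_nat_diff)
    finally show ?thesis using x by simp
  qed
  finally have "norm ((\<Sum>x\<in>N. (1 / card N) *\<^sub>R x) - y) \<le> (1 / card N) * (d / 2 + (real (card N) - 1) * d)"
    using n by (simp add: mult_left_mono divide_right_mono)
  also have "\<dots> = d - d / (2 * card N)"
    using n by (simp add: field_simps)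
  finally show ?thesis .
qed

theorem common_fixed_point:
  fixes act :: "'s::semitopological_semigroup \<Rightarrow> 'a::real_normed_vector \<Rightarrow> 'a"
    and \<mu> :: "('s \<Rightarrow>\<^sub>C complex) \<Rightarrow> complex"
  assumes E: "compactin weak_topology E" "E \<noteq> {}" "convex E" "bounded E"
    and D: "continuous_dynamical_system act (subtopology weak_topology E)"
    and ne: "nonexpansive_on E act" and \<mu>: "left_invariant_mean \<mu>"
  obtains x where "x \<in> E" "\<And>s. act s x = x"
proof -
  have inE: "act s x \<in> E" if "x \<in> E" for s x
    using D that by (auto simp: continuous_dynamical_system_def dynamical_system_def)
  define stable where "stable K \<longleftrightarrow> (\<forall>s. act s ` K \<subseteq> K)" for K
  have "convex E \<and> stable E"
    using E(3) inE by (auto simp: stable_def)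
  moreover have "convex (\<Inter>\<C>) \<and> stable (\<Inter>\<C>)"
    if "\<And>K. K \<in> \<C> \<Longrightarrow> convex K \<and> stable K" for \<C>
    using that by (auto simp: stable_def intro!: convex_Inter) blast
  ultimately have "\<exists>K\<subseteq>E. compactin weak_topology K \<and> K \<noteq> {} \<and> (convex K \<and> stable K) \<and>
      (\<forall>K'\<subseteq>K. compactin weak_topology K' \<longrightarrow> K' \<noteq> {} \<longrightarrow> convex K' \<and> stable K' \<longrightarrow> K' = K)"
    by (rule minimal_compact_subset[OF Hausdorff_weak_topology E(1,2)])
  then obtain K where K: "K \<subseteq> E" "compactin weak_topology K" "K \<noteq> {}" "convex K" "stable K"
    and K_min: "\<And>K'. K' \<subseteq> K \<Longrightarrow> compactin weak_topology K' \<Longrightarrow> K' \<noteq> {} \<Longrightarrow> convex K' \<and> stable K' \<Longrightarrow> K' = K"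
    by (elim exE conjE) auto
  have "stable (\<Inter>\<C>)" if "\<And>K. K \<in> \<C> \<Longrightarrow> stable K" for \<C>
    using that by (auto simp: stable_def) blast
  \<comment> \<open>Minimality among all compact invariant sets, convex or not, is what the
    invariant functional exploits, so \<open>F\<close> itself need not be convex.\<close>
  with K(5) have "\<exists>F\<subseteq>K. compactin weak_topology F \<and> F \<noteq> {} \<and> stable F \<and>
      (\<forall>G\<subseteq>F. compactin weak_topology G \<longrightarrow> G \<noteq> {} \<longrightarrow> stable G \<longrightarrow> G = F)"
    by (rule minimal_compact_subset[OF Hausdorff_weak_topology K(2,3)])
  then obtain F where F: "F \<subseteq> K" "compactin weak_topology F" "F \<noteq> {}" "stable F"
    and F_min: "\<And>G. G \<subseteq> F \<Longrightarrow> compactin weak_topology G \<Longrightarrow> G \<noteq> {} \<Longrightarrow> stable G \<Longrightarrow> G = F"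
    by (elim exE conjE) auto
  define T where "T = subtopology weak_topology F"
  have topT: "topspace T = F"
    by (simp add: T_def)
  have FE: "F \<subseteq> E"
    using F(1) K(1) by simp
  have "T = subtopology (subtopology weak_topology E) F"
    using FE by (simp add: T_def subtopology_subtopology inf_absorb2)
  then have DT: "continuous_dynamical_system act T"
    using continuous_dynamical_system_subtopology[OF D, of F] FE F(4) by (auto simp: stable_def)
  have cT: "compact_space T" "topspace T \<noteq> {}"
    using F by (auto simp: T_def intro: compact_space_subtopology)
  obtain m where m:
    "\<And>f g. continuous_map T euclideanreal f \<Longrightarrow> continuous_map T euclideanreal g \<Longrightarrow>
       m (\<lambda>x. f x + g x) = m f + m g"
    "\<And>c f. continuous_map T euclideanreal f \<Longrightarrow> m (\<lambda>x. c * f x) = c * m f"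
    "\<And>f. continuous_map T euclideanreal f \<Longrightarrow> \<forall>x\<in>topspace T. f x \<ge> 0 \<Longrightarrow> m f \<ge> 0"
    "m (\<lambda>_. 1) = 1"
    "\<And>s f. continuous_map T euclideanreal f \<Longrightarrow> m (\<lambda>x. f (act s x)) = m f"
    by (rule left_invariant_mean_imp_invariant_functional[OF DT cT \<mu>]) (rule that)
  interpret minimal_nonexpansive_system T act m
  proof
    show "Hausdorff_space T"
      by (simp add: T_def Hausdorff_space_subtopology Hausdorff_weak_topology)
    show "continuous_map T T (act s)" for s
      using DT by (auto simp: continuous_dynamical_system_def dynamical_system_def)
    show "G = topspace T" if G: "closedin T G" "G \<noteq> {}" "\<And>s. act s ` G \<subseteq> G" for G
      unfolding topT
    proof (rule F_min)
      have "compactin T G"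
        by (rule closedin_compact_space[OF cT(1) G(1)])
      then show "G \<subseteq> F" "compactin weak_topology G"
        by (auto simp: T_def compactin_subtopology)
    qed (use G in \<open>auto simp: stable_def\<close>)
    show "norm (act s x - act s y) \<le> norm (x - y)" if "x \<in> topspace T" "y \<in> topspace T" for x y s
      using ne that FE by (auto simp: nonexpansive_on_def topT)
    have "prod_topology T T = subtopology (prod_topology weak_topology weak_topology) (F \<times> F)"
      by (simp add: T_def subtopology_Times)
    moreover have "{(x, y) \<in> topspace T \<times> topspace T. r < norm (x - y)} = {(x, y). r < norm (x - y)} \<inter> F \<times> F" for r
      by (auto simp: topT)
    ultimately show "openin (prod_topology T T) {(x, y) \<in> topspace T \<times> topspace T. r < norm (x - y)}" for r
      using openin_weak_norm_gt openin_subtopology_Int by metis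
    show "0 \<le> m f" if "continuous_map T euclideanreal f" "\<And>x. x \<in> topspace T \<Longrightarrow> f x \<ge> 0" for f
      using m(3) that by blast
  qed (fact cT m)+
  have surj: "act s ` F = F" for s
    using act_surj by (simp add: topT)
  obtain p where p: "p \<in> F"
    using F(3) by auto
  have single: "x = y" if xy: "x \<in> F" "y \<in> F" for x y
  proof (rule ccontr)
    assume "x \<noteq> y"
    define d where "d = diameter F"
    have bF: "bounded F"
      using FE E(4) bounded_subset by blast
    have diam: "norm (x - y) \<le> d" if "x \<in> F" "y \<in> F" for x y
      using diameter_bounded_bound[OF bF that] by (simp add: d_def dist_norm)
    have d: "d > 0"
      using diam[OF xy] \<open>x \<noteq> y\<close> by (meson less_le_trans right_minus_eq zero_less_norm_iff)
    \<comment> \<open>With \<open>r = d / 4\<close>, \<open>finite_net\<close> turns an open piece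
      in a ball of radius \<open>r / 2\<close> into a net of mesh
      \<open>2 * r = d / 2\<close>.\<close>
    then have "d / 8 > 0"
      by simp
    then obtain U z where U: "openin T U" "U \<noteq> {}" "U \<subseteq> cball z (d / 8)"
      unfolding T_def by (rule weakly_compact_fragmented[OF F(2,3)])
    have "U \<subseteq> cball z (d / 4 / 2)"
      using U(3) by simp
    with U(1,2) obtain N where N: "finite N" "N \<noteq> {}" "N \<subseteq> F"
      and net: "\<And>y. y \<in> F \<Longrightarrow> \<exists>x\<in>N. norm (x - y) \<le> d / 2"
      by (rule finite_net) (auto simp: topT)
    define u where "u = (\<Sum>x\<in>N. (1 / card N) *\<^sub>R x)"
    define \<rho> where "\<rho> = d - d / (2 * card N)"
    have card: "card N > 0"
      using N card_gt_0_iff by blast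
    have "u \<in> K"
      unfolding u_def
    proof (rule convex_sum)
      show "(\<Sum>x\<in>N. 1 / real (card N)) = 1"
        using card by simp
    qed (use N F(1) K(4) in auto)
    have u: "norm (u - y) \<le> \<rho>" if "y \<in> F" for y
    proof -
      obtain x where "x \<in> N" "norm (x - y) \<le> d / 2"
        using net[OF \<open>y \<in> F\<close>] by auto
      then show ?thesis
        unfolding u_def \<rho>_def using N diam that by (intro norm_mean_diff_le) auto
    qed
    \<comment> \<open>The points of \<open>K\<close> that see all of \<open>F\<close> within
      \<open>\<rho> < d\<close>; the mean \<open>u\<close> is one of them.\<close>
    define K' where "K' = K \<inter> (\<Inter>y\<in>F. cball y \<rho>)"
    have K': "x \<in> K' \<longleftrightarrow> x \<in> K \<and> (\<forall>y\<in>F. norm (x - y) \<le> \<rho>)" for x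
      by (auto simp: K'_def dist_norm norm_minus_commute)
    have "K' = K"
    proof (rule K_min)
      show "K' \<subseteq> K"
        by (auto simp: K')
      have "closedin weak_topology (\<Inter>y\<in>F. cball y \<rho>)"
        using F(3) closedin_weak_cball by (intro closedin_INT) auto
      then show "compactin weak_topology K'"
        unfolding K'_def by (rule compact_Int_closedin[OF K(2)])
      show "K' \<noteq> {}"
        using \<open>u \<in> K\<close> u K' by blast
      have "convex K'"
        unfolding K'_def using K(4) by (intro convex_Int convex_INT) auto
      moreover have "act s x \<in> K'" if x: "x \<in> K'" for s x
        unfolding K'
      proof (intro conjI ballI)
        show "act s x \<in> K"
          using K(5) x K' by (auto simp: stable_def)
        fix y assume "y \<in> F"
        \<comment> \<open>Since \<open>act s\<close> maps \<open>F\<close> onto \<open>F\<close>,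
          every target \<open>y\<close> has a preimage in \<open>F\<close> to which nonexpansiveness
          applies.\<close>
        then obtain y' where y': "y' \<in> F" "y = act s y'"
          using surj[of s] by auto
        have "x \<in> E" "y' \<in> E"
          using x y'(1) K' K(1) FE by auto
        then have "norm (act s x - act s y') \<le> norm (x - y')"
          using ne by (simp add: nonexpansive_on_def)
        also have "\<dots> \<le> \<rho>"
          using x y'(1) K' by auto
        finally show "norm (act s x - y) \<le> \<rho>"
          by (simp add: y')
      qed
      ultimately show "convex K' \<and> stable K'"
        by (auto simp: stable_def)
    qed
    \<comment> \<open>\<open>F\<close> lies in \<open>K = K'\<close>, so its diameter would be
      smaller than itself.\<close>
    then have "norm (x - y) \<le> \<rho>" if "x \<in> F" "y \<in> F" for x y
      using K' F(1) that by blast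
    then have "diameter F \<le> \<rho>"
      using F(3) by (intro diameter_le) auto
    moreover have "0 < d / (2 * card N)"
      using d card by (intro divide_pos_pos) auto
    ultimately show False
      by (simp add: d_def[symmetric] \<rho>_def)
  qed
  show thesis
  proof (rule that[of p])
    show "p \<in> E"
      using p FE by auto
    show "act s p = p" for s
      using single[of "act s p" p] surj[of s] p by blast
  qed
qed

section \<open>Fixed points in the Chebyshev center\<close>

theorem theorem4p6:
  fixes act :: "'s::semitopological_semigroup \<Rightarrow> 'a::banach \<Rightarrow> 'a"
    and C A :: "'a set"
  assumes "bounded C" and "convex C" and "L_embedded C"
    and "continuous_dynamical_system act (subtopology weak_topology C)"
    and "nonexpansive_on C act"
    and "\<exists>\<mu> :: ('s \<Rightarrow>\<^sub>C complex) \<Rightarrow> complex. left_invariant_mean \<mu>"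
    and "A \<subseteq> C" and "A \<noteq> {}" and "bounded A"
    and "\<And>s. act s ` A = A"
  shows "\<exists>x\<in>chebyshev_center C A. \<forall>s. act s x = x"
proof -
  let ?E = "chebyshev_center C A"
  obtain \<mu> :: "('s \<Rightarrow>\<^sub>C complex) \<Rightarrow> complex" where \<mu>: "left_invariant_mean \<mu>"
    using assms(6) by auto
  note E_iff = chebyshev_center_iff[OF assms(8,9), of _ C]
  have EC: "?E \<subseteq> C"
    using E_iff by blast
  have inC: "act s x \<in> C" if "x \<in> C" for s x
    using assms(4) that by (auto simp: continuous_dynamical_system_def dynamical_system_def)
  \<comment> \<open>Because \<open>act s\<close> maps \<open>A\<close> onto \<open>A\<close>, each
    point of \<open>A\<close> is an image of a point of \<open>A\<close>, and nonexpansiveness keeps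
    the distance within the radius.\<close>
  have inv: "act s ` ?E \<subseteq> ?E" for s
  proof (intro image_subsetI)
    fix x assume x: "x \<in> ?E"
    show "act s x \<in> ?E"
      unfolding E_iff
    proof (intro conjI ballI)
      show "act s x \<in> C"
        using x EC by (intro inC) auto
      fix y assume "y \<in> A"
      then obtain y' where y': "y' \<in> A" "y = act s y'"
        using assms(10)[of s] by auto
      have "x \<in> C" "y' \<in> C"
        using x y'(1) EC assms(7) by auto
      then have "norm (act s x - act s y') \<le> norm (x - y')"
        using assms(5) by (simp add: nonexpansive_on_def)
      also have "\<dots> \<le> chebyshev_radius C A"
        using x y'(1) E_iff by blast
      finally show "norm (act s x - y) \<le> chebyshev_radius C A"
        by (simp add: y')
    qed
  qed
  have "subtopology (subtopology weak_topology C) ?E = subtopology weak_topology ?E"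
    using EC by (simp add: subtopology_subtopology inf_absorb2)
  then have D: "continuous_dynamical_system act (subtopology weak_topology ?E)"
    using continuous_dynamical_system_subtopology[OF assms(4), of ?E] EC inv by simp
  have ne: "nonexpansive_on ?E act"
    using assms(5) EC by (auto simp: nonexpansive_on_def)
  obtain x where "x \<in> ?E" "\<And>s. act s x = x"
  proof (rule common_fixed_point[OF _ _ _ _ D ne \<mu>])
    show "compactin weak_topology ?E" "?E \<noteq> {}"
      using L_embedded_chebyshev_center[OF assms(3,1,8,9)] by auto
    show "convex ?E"
      by (rule convex_chebyshev_center[OF assms(2,8,9)])
    show "bounded ?E"
      using assms(1) EC by (rule bounded_subset)
  qed (rule that)
  then show ?thesis by blast
qed

end
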